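(* For every $\mathfrak{m}\in\mathcal{P}_2(2k)$ and every integer $d$ with $d\ge 2k$ and $d>12k^{7/2}$, $$\#P(\mathfrak{m},|\mathfrak{m}|)\,\frac{1-\frac{24k^{7/2}}{d}}{1-\frac{144k^7}{d^2}}\le(-1)^{|\mathfrak{m}|}d^{|\mathfrak{m}|+k}\,\mathrm{Wg}^{\mathrm{O}}(\mathfrak{m},d)\le\frac{\#P(\mathfrak{m},|\mathfrak{m}|)}{1-\frac{144k^7}{d^2}}.$$
   Context: $\mathcal{P}_2(2k)$ is the set of pair partitions of $\{1,\dots,2k\}$; $\mathcal{P}_2(0)=\{\emptyset\}$; $S_{2k}$ acts on it by applying the permutation to every element of every block. The coset-type of $\mathfrak{m}$ is the partition $\mu$ of $k$ such that the connected components of the graph on $\{1,\dots,2k\}$ whose edges are the blocks of $\mathfrak{e}_k=\{1,2\}\cdots\{2k-1,2k\}$ and of $\mathfrak{m}$ have sizes $2\mu_1,2\mu_2,\dots$; $|\mathfrak{m}|=k-\ell(\mu)$. For integers $d\ge 2k$, $\mathrm{Wg}^{\mathrm{O}}(\mathfrak{m},d)=\int_{\mathrm{O}(d)}u_{i_1j_1}\cdots u_{i_{2k}j_{2k}}\,d\mu(U)$, where $\mu$ is Haar probability on $\mathrm{O}(d)$, $\mathbf{i}\in\{1,\dots,d\}^{2k}$ has $i_r=i_s\iff\{r,s\}\in\mathfrak{e}_k$ and $\mathbf{j}$ has $j_r=j_s\iff\{r,s\}\in\mathfrak{m}$ (for $r\ne s$). The orthogonal Weingarten graph has vertex set $\bigsqcup_{k\ge0}\mathcal{P}_2(2k)$,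 a solid arrow $\mathfrak{m}\to(i,2k-1).\mathfrak{m}$ for every $\mathfrak{m}\in\mathcal{P}_2(2k)$ and $1\le i<2k-1$, and a dashed arrow $\mathfrak{m}\dashrightarrow\mathfrak{m}^{\downarrow}$ whenever $\{2k-1,2k\}\in\mathfrak{m}$, with $\mathfrak{m}^{\downarrow}$ being $\mathfrak{m}$ with that block removed. $P(\mathfrak{m},l)$ is the set of paths $(\mathfrak{m}_0=\mathfrak{m},\dots,\mathfrak{m}_{l+k}=\emptyset)$ following arrows at each step, using $l$ solid and $k$ dashed arrows. *)

theory Defs
  imports
    "HOL-Probability.Probability"
    "HOL-Combinatorics.Transposition"
    "HOL-Library.Disjoint_Sets"
    "HOL-Library.Multiset"
begin

definition pair_partitions :: "nat \<Rightarrow> nat set set set" where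
  "pair_partitions k = {m. partition_on {1..2*k} m \<and> (\<forall>b\<in>m. card b = 2)}"

definition trivial_pairing :: "nat \<Rightarrow> nat set set" where
  "trivial_pairing k = (\<lambda>r. {2*r - 1, 2*r}) ` {1..k}"

definition perm_act :: "(nat \<Rightarrow> nat) \<Rightarrow> nat set set \<Rightarrow> nat set set" where
  "perm_act \<sigma> m = (\<lambda>b. \<sigma> ` b) ` m"

definition pairing_components :: "nat \<Rightarrow> nat set set \<Rightarrow> nat set set" where
  "pairing_components k m =
     {1..2*k} // {(x, y). {x, y} \<in> trivial_pairing k \<union> m}\<^sup>*"

text \<open>The coset-type, a partition of \<open>k\<close>, is encoded as the multiset of its parts.\<close>

definition coset_type :: "nat \<Rightarrow> nat set set \<Rightarrow> nat multiset" where
  "coset_type k m = image_mset (\<lambda>C. card C div 2) (mset_set (pairing_components k m))"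

text \<open>For \<open>m \<in> pair_partitions k\<close> every component has at least two elements, so there are at most
  \<open>k\<close> of them and the subtraction below does not truncate.\<close>

definition pairing_norm :: "nat \<Rightarrow> nat set set \<Rightarrow> nat" where
  "pairing_norm k m = k - size (coset_type k m)"

text \<open>The vertices of the Weingarten graph are the elements of \<open>\<Union>k. pair_partitions k\<close>; this union
  is disjoint, since \<open>m \<in> pair_partitions k\<close> covers exactly \<open>{1..2*k}\<close>.  Distinct \<open>i\<close> give distinct
  targets \<open>(i, 2k-1).m\<close>, so arrows may be treated as relations.  When \<open>i\<close> is the partner
  of \<open>2k-1\<close> in \<open>m\<close>, the solid arrow is a loop, and it counts as a step of a path.\<close>

definition solid_arrow :: "nat set set \<Rightarrow> nat set set \<Rightarrow> bool" where
  "solid_arrow m n \<longleftrightarrow>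
     (\<exists>k i. m \<in> pair_partitions k \<and> 1 \<le> i \<and> i < 2*k - 1 \<and>
            n = perm_act (Transposition.transpose i (2*k - 1)) m)"

definition dashed_arrow :: "nat set set \<Rightarrow> nat set set \<Rightarrow> bool" where
  "dashed_arrow m n \<longleftrightarrow>
     (\<exists>k\<ge>1. m \<in> pair_partitions k \<and> {2*k - 1, 2*k} \<in> m \<and> n = m - {{2*k - 1, 2*k}})"

definition weingarten_paths :: "nat \<Rightarrow> nat set set \<Rightarrow> nat \<Rightarrow> nat set set list set" where
  "weingarten_paths k m l =
     {p. length p = l + k + 1 \<and> p ! 0 = m \<and> p ! (l + k) = {} \<and>
         (\<forall>t<l + k. solid_arrow (p ! t) (p ! Suc t) \<or> dashed_arrow (p ! t) (p ! Suc t)) \<and>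
         card {t. t < l + k \<and> solid_arrow (p ! t) (p ! Suc t)} = l \<and>
         card {t. t < l + k \<and> dashed_arrow (p ! t) (p ! Suc t)} = k}"

text \<open>The Haar probability measure on \<open>O(d)\<close>, where \<open>d = CARD('n)\<close>: the left-invariant Borel
  probability measure on the space of orthogonal matrices.\<close>

definition haar_orthogonal :: "(real ^ 'n ^ 'n) measure \<Rightarrow> bool" where
  "haar_orthogonal M \<longleftrightarrow>
     prob_space M \<and>
     sets M = sets (restrict_space borel {U. orthogonal_matrix U}) \<and>
     (\<forall>V. orthogonal_matrix V \<longrightarrow> distr M M (\<lambda>U. V ** U) = M)"

definition index_pattern :: "nat \<Rightarrow> (nat \<Rightarrow> 'n) \<Rightarrow> nat set set \<Rightarrow> bool" where
  "index_pattern k f m \<longleftrightarrow>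
     (\<forall>r\<in>{1..2*k}. \<forall>s\<in>{1..2*k}. r \<noteq> s \<longrightarrow> (f r = f s \<longleftrightarrow> {r, s} \<in> m))"

text \<open>When \<open>M\<close> is the Haar measure, \<open>i\<close> has pattern \<open>trivial_pairing k\<close> and \<open>j\<close> has pattern \<open>m\<close>,
  this integral is the orthogonal Weingarten function at \<open>m\<close> and \<open>d = CARD('n)\<close>; its value does
  not depend on the choice of such \<open>i\<close> and \<open>j\<close>.\<close>

definition Wg_O ::
  "(real ^ 'n ^ 'n) measure \<Rightarrow> nat \<Rightarrow> (nat \<Rightarrow> 'n) \<Rightarrow> (nat \<Rightarrow> 'n) \<Rightarrow> real" where
  "Wg_O M k i j = (\<integral>U. (\<Prod>r\<in>{1..2*k}. U $ i r $ j r) \<partial>M)"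

end

theory Submission imports Defs begin

text \<open>The Weingarten functions satisfy the linear recursion
  \<open>d Wg(m) + \<Sum>\<^sub>i Wg((i, 2k-1).m) = [{2k-1, 2k} \<in> m] Wg(m\<downarrow>)\<close>: sum the integral over the
  row index of the last two factors.  Orthogonality of the columns gives the right-hand side, a new
  row gives \<open>Wg(m)\<close>, and a row that already occurs, and now carries four factors, is resolved by
  reflecting it against a new one.  Only left invariance is needed.  For \<open>d > 2k - 2\<close> the recursion
  determines the Weingarten functions, so \<open>d\<^sup>k Wg(m)\<close> is the sum over \<open>l\<close>
  of \<open>#P(m, l) (-1/d)\<^sup>l\<close>.

  A solid arrow at a component of size \<open>2a\<close> splits it into all pairs of sizes \<open>(2s, 2a - 2s)\<close>,
  once each, or leaves it unchanged, or merges it with another one. Hence \<open>#P(m, l) = 0\<close> for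
  \<open>l < |m|\<close>, and \<open>#P(m, |m|)\<close> is a product of Catalan numbers, which changes by at most a
  polynomial factor when components are merged. This yields
  \<open>#P(m, |m| + g) \<le> (12 k\<^sup>3)\<^sup>g #P(m, |m|)\<close>, and the two bounds follow by comparing the even
  and the odd terms of the alternating series with geometric series.\<close>

section \<open>The recursion for the Weingarten functions\<close>

text \<open>Counting at most \<open>2k\<close> choices per solid step is too crude, since the bounds
  must be relative to \<open>#P(m, |m|)\<close>. A relative bound is possible because the Catalan
  weight is harmonic: the weights of all splits of \<open>m\<close>, together with the weight of
  \<open>m\<close> without its last block when \<open>m\<close> contains that block, add up to the
  weight of \<open>m\<close>. A bound of the form constant times weight thus passes through splits
  and dashed arrows without loss, and only reversals and merges cost something.

  The exponent 3 is a balance. A reversal has about \<open>2k\<close> places and \<open>2k\<close>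
  choices, so it costs \<open>4 k^2\<close> for one unit of excess. A merge costs a further
  \<open>4 k^4\<close>, from comparing Catalan numbers with powers of 4, but it uses two units:
  \<open>16 k^6\<close> in all, or \<open>4 k^3\<close> per unit. The constant 12 absorbs both. The
  statement is reached through \<open>k^3 \<le> k^(7/2)\<close>: with
  \<open>x = 12 k^(7/2) / d\<close> as ratio of the geometric series,
  \<open>x^2 = 144 k^7 / d^2\<close> and \<open>2 x = 24 k^(7/2) / d\<close>.\<close>

lemma trivial_pairing_mem_iff:
  assumes "r \<noteq> s"
  shows "{r, s} \<in> trivial_pairing k \<longleftrightarrow>
    (\<exists>t\<in>{1..k}. r = 2 * t - 1 \<and> s = 2 * t \<or> r = 2 * t \<and> s = 2 * t - 1)"
  using assms by (auto simp: trivial_pairing_def doubleton_eq_iff image_iff)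

lemma sum_pairs:
  fixes f :: "nat \<Rightarrow> 'a::comm_monoid_add"
  shows "(\<Sum>t\<in>{1..2*n}. f t) = (\<Sum>r\<in>{1..n}. f (2*r-1) + f (2*r))"
  by (induction n) (simp_all add: algebra_simps)

text \<open>Row \<open>a\<close> becomes \<open>c a + s b\<close> and row \<open>b\<close> becomes
  \<open>s a - c b\<close>. One family serves two purposes: \<open>c = 0\<close>,
  \<open>s = 1\<close> swaps the rows, equal \<open>c\<close> and \<open>s\<close> mix them. A
  reflection is symmetric, so its orthogonality only requires its square.\<close>

definition row_reflection :: "'n \<Rightarrow> 'n \<Rightarrow> real \<Rightarrow> real \<Rightarrow> real ^ 'n ^ 'n" where
  "row_reflection a b c s = (\<chi> p q.
     if p = a then (if q = a then c else 0) + (if q = b then s else 0)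
     else if p = b then (if q = a then s else 0) - (if q = b then c else 0)
     else if q = p then 1 else 0)"

lemma row_reflection_mult:
  assumes "a \<noteq> b"
  shows "(row_reflection a b c s ** U) $ p $ q =
    (if p = a then c * U $ a $ q + s * U $ b $ q
     else if p = b then s * U $ a $ q - c * U $ b $ q else U $ p $ q)"
  by (simp add: row_reflection_def matrix_matrix_mult_def if_distrib[of "\<lambda>x. x * _"]
      distrib_right left_diff_distrib sum.distrib sum_subtractf cong: if_cong)

lemma orthogonal_row_reflection:
  fixes a b :: "'n::finite"
  assumes "a \<noteq> b" "c\<^sup>2 + s\<^sup>2 = 1"
  shows "orthogonal_matrix (row_reflection a b c s)"
proof -
  have 1: "row_reflection a b c s ** row_reflection a b c s = mat 1"
    using assms
    by (auto simp: vec_eq_iff row_reflection_mult mat_def)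
      (auto simp: row_reflection_def power2_eq_square algebra_simps)
  have 2: "transpose (row_reflection a b c s) = row_reflection a b c s"
    using assms by (auto simp: vec_eq_iff row_reflection_def transpose_def)
  show ?thesis by (simp add: orthogonal_matrix_def 1 2)
qed

section \<open>Haar integration of polynomials in the matrix entries\<close>

locale orthogonal_haar =
  fixes M :: "(real ^ 'n ^ 'n) measure"
  assumes haar: "haar_orthogonal M"
begin

sublocale prob_space M using haar by (simp add: haar_orthogonal_def)

lemma sets_M: "sets M = sets (restrict_space borel {U. orthogonal_matrix U})"
  using haar by (simp add: haar_orthogonal_def)

lemma space_M: "space M = {U. orthogonal_matrix U}"
  using sets_eq_imp_space_eq[OF sets_M] by (simp add: space_restrict_space)

text \<open>Boundedness is included because, unlike integrability, it survives products; all
  polynomials in the entries are then covered by introduction rules.\<close>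

definition tame :: "(real ^ 'n ^ 'n \<Rightarrow> real) \<Rightarrow> bool" where
  "tame f \<longleftrightarrow> f \<in> borel_measurable M \<and> (\<exists>B. \<forall>U\<in>space M. \<bar>f U\<bar> \<le> B)"

lemma tame_integrable: "tame f \<Longrightarrow> integrable M f"
  by (force simp: tame_def intro: integrable_const_bound)

lemma abs_entry_le_1:
  assumes "U \<in> space M"
  shows "\<bar>U $ a $ b\<bar> \<le> 1"
proof -
  have "U ** transpose U = mat 1" using assms by (simp add: space_M orthogonal_matrix_def)
  then have "(U ** transpose U) $ a $ a = 1" by (simp add: mat_def)
  then have "(\<Sum>c\<in>UNIV. (U $ a $ c)\<^sup>2) = 1"
    by (simp add: matrix_matrix_mult_def transpose_def power2_eq_square)
  moreover have "(U $ a $ b)\<^sup>2 \<le> (\<Sum>c\<in>UNIV. (U $ a $ c)\<^sup>2)"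
    by (rule member_le_sum) auto
  ultimately show ?thesis by (simp add: abs_square_le_1)
qed

lemma tame_entry [intro]: "tame (\<lambda>U. U $ a $ b)"
proof -
  have "(\<lambda>U::real ^ 'n ^ 'n. U $ a $ b) \<in> borel_measurable borel"
    by (intro borel_measurable_continuous_onI continuous_intros)
  then have "(\<lambda>U. U $ a $ b) \<in> borel_measurable M"
    unfolding measurable_cong_sets[OF sets_M refl] by (rule measurable_restrict_space1)
  with abs_entry_le_1 show ?thesis by (auto simp: tame_def)
qed

lemma tame_const [intro]: "tame (\<lambda>U. c)"
  by (auto simp: tame_def)

lemma tame_add [intro]: "tame f \<Longrightarrow> tame g \<Longrightarrow> tame (\<lambda>U. f U + g U)"
  unfolding tame_def by (force intro: order_trans[OF abs_triangle_ineq] add_mono)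

lemma tame_mult [intro]: "tame f \<Longrightarrow> tame g \<Longrightarrow> tame (\<lambda>U. f U * g U)"
proof -
  assume f: "tame f" and g: "tame g"
  from f obtain B where B: "\<forall>U\<in>space M. \<bar>f U\<bar> \<le> B" by (auto simp: tame_def)
  from g obtain C where C: "\<forall>U\<in>space M. \<bar>g U\<bar> \<le> C" by (auto simp: tame_def)
  have "\<forall>U\<in>space M. \<bar>f U * g U\<bar> \<le> \<bar>B\<bar> * \<bar>C\<bar>"
  proof
    fix U assume "U \<in> space M"
    with B C have "\<bar>f U\<bar> \<le> \<bar>B\<bar>" "\<bar>g U\<bar> \<le> \<bar>C\<bar>" by (meson abs_ge_self order_trans)+
    then show "\<bar>f U * g U\<bar> \<le> \<bar>B\<bar> * \<bar>C\<bar>" by (simp add: abs_mult mult_mono)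
  qed
  with f g show ?thesis by (auto simp: tame_def)
qed

lemma tame_prod [intro]: "(\<And>x. x \<in> A \<Longrightarrow> tame (f x)) \<Longrightarrow> tame (\<lambda>U. \<Prod>x\<in>A. f x U)"
  by (induction A rule: infinite_finite_induct) auto

lemma integral_rotate:
  assumes "orthogonal_matrix V" "tame f"
  shows "(\<integral>U. f (V ** U) \<partial>M) = (\<integral>U. f U \<partial>M)"
proof -
  have "(\<lambda>U::real ^ 'n ^ 'n. V ** U) \<in> borel_measurable borel"
    unfolding matrix_matrix_mult_def
    by (intro borel_measurable_continuous_onI continuous_intros)
  then have "(\<lambda>U. V ** U) \<in> borel_measurable M"
    unfolding measurable_cong_sets[OF sets_M refl] by (rule measurable_restrict_space1)
  then have "(\<lambda>U. V ** U) \<in> measurable M (restrict_space borel {U. orthogonal_matrix U})"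
    using assms(1) by (intro measurable_restrict_space2) (auto simp: space_M orthogonal_matrix_mul)
  then have m: "(\<lambda>U. V ** U) \<in> measurable M M"
    by (simp add: measurable_cong_sets[OF refl sets_M])
  have "(\<integral>U. f U \<partial>M) = (\<integral>U. f U \<partial>distr M M (\<lambda>U. V ** U))"
    using haar assms(1) by (simp add: haar_orthogonal_def)
  also have "\<dots> = (\<integral>U. f (V ** U) \<partial>M)"
    using assms(2) m by (intro integral_distr) (auto simp: tame_def)
  finally show ?thesis by simp
qed

text \<open>The hypothesis on \<open>G\<close> stands for a function that ignores rows
  \<open>a\<close> and \<open>b\<close>; asking it for all \<open>c\<close> and \<open>s\<close>
  lets one hypothesis serve both the swap and the mixing of the rows.\<close>

lemma integral_swap_rows:
  assumes "a \<noteq> b" "tame G" "\<And>c s U. G (row_reflection a b c s ** U) = G U" "tame F"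
  shows "(\<integral>U. G U * F (row_reflection a b 0 1 ** U) \<partial>M) = (\<integral>U. G U * F U \<partial>M)"
  using integral_rotate[OF orthogonal_row_reflection[OF assms(1), of 0 1] tame_mult[OF assms(2,4)]]
  by (simp add: assms(3))

text \<open>The idea is invariance under the reflection that sends rows \<open>a\<close> and \<open>b\<close> to
  \<open>(a + b) / sqrt 2\<close> and \<open>(a - b) / sqrt 2\<close>.\<close>

lemma integral_four_in_row:
  assumes ab: "a \<noteq> b" and G: "tame G" "\<And>c s U. G (row_reflection a b c s ** U) = G U"
  shows "(\<integral>U. G U * (U $ a $ p * U $ a $ q * U $ a $ s * U $ a $ t) \<partial>M) =
      (\<integral>U. G U * (U $ a $ p * U $ a $ q * U $ b $ s * U $ b $ t) \<partial>M)
    + (\<integral>U. G U * (U $ a $ s * U $ a $ q * U $ b $ p * U $ b $ t) \<partial>M)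
    + (\<integral>U. G U * (U $ a $ p * U $ a $ s * U $ b $ q * U $ b $ t) \<partial>M)"
proof -
  define J where "J e f g h = (\<integral>U. G U * (U $ e $ p * U $ f $ q * U $ g $ s * U $ h $ t) \<partial>M)"
    for e f g h
  define h :: real where "h = 1 / sqrt 2"
  define V where "V = row_reflection a b h h"
  have h2: "h\<^sup>2 = 1/2" by (simp add: h_def power_divide)
  then have "h * h = 1/2" by (simp add: power2_eq_square)
  then have "(h * h) * (h * h) = (1/2) * (1/2)" by (simp only:)
  then have h4: "h * (h * (h * h)) = 1/4" by (simp add: mult.assoc)
  \<comment> \<open>Both rows are taken together because the product of the sums plus the product of
    the differences keeps only the monomials of even degree in row \<open>b\<close>: 8 of 16, each
    with coefficient \<open>2 h^4 = 1/2\<close>.\<close>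
  define F where "F U = U $ a $ p * U $ a $ q * U $ a $ s * U $ a $ t
      + U $ b $ p * U $ b $ q * U $ b $ s * U $ b $ t" for U :: "real ^ 'n ^ 'n"
  have F: "F (V ** U) = 1/2 * (F U
      + U $ a $ p * U $ a $ q * U $ b $ s * U $ b $ t
      + U $ b $ p * U $ b $ q * U $ a $ s * U $ a $ t
      + U $ a $ p * U $ b $ q * U $ a $ s * U $ b $ t
      + U $ b $ p * U $ a $ q * U $ b $ s * U $ a $ t
      + U $ a $ p * U $ b $ q * U $ b $ s * U $ a $ t
      + U $ b $ p * U $ a $ q * U $ a $ s * U $ b $ t)" for U
  proof -
    have "F (V ** U) = h * (h * (h * h)) *
       ((U $ a $ p + U $ b $ p) * (U $ a $ q + U $ b $ q) * (U $ a $ s + U $ b $ s) * (U $ a $ t + U $ b $ t)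
      + (U $ a $ p - U $ b $ p) * (U $ a $ q - U $ b $ q) * (U $ a $ s - U $ b $ s) * (U $ a $ t - U $ b $ t))"
      using ab by (simp add: F_def V_def row_reflection_mult algebra_simps)
    then show ?thesis unfolding h4 by (simp add: F_def algebra_simps)
  qed
  have int: "integrable M (\<lambda>U. G U * (U $ e $ p * U $ f $ q * U $ g $ s * U $ h $ t))" for e f g h
    by (intro tame_integrable tame_mult tame_entry G(1))
  have V: "orthogonal_matrix V"
    unfolding V_def using ab h2 by (intro orthogonal_row_reflection) auto
  have "tame (\<lambda>U. G U * F U)" unfolding F_def by (intro tame_mult tame_add tame_entry G(1))
  from integral_rotate[OF V this] G(2)
  have "(\<integral>U. G U * F (V ** U) \<partial>M) = (\<integral>U. G U * F U \<partial>M)" by (simp add: V_def)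
  also have "\<dots> = J a a a a + J b b b b"
    unfolding J_def F_def distrib_left using int by simp
  also have "(\<integral>U. G U * F (V ** U) \<partial>M) = (\<integral>U. 1/2 * (
        G U * (U $ a $ p * U $ a $ q * U $ a $ s * U $ a $ t)
      + G U * (U $ b $ p * U $ b $ q * U $ b $ s * U $ b $ t)
      + G U * (U $ a $ p * U $ a $ q * U $ b $ s * U $ b $ t)
      + G U * (U $ b $ p * U $ b $ q * U $ a $ s * U $ a $ t)
      + G U * (U $ a $ p * U $ b $ q * U $ a $ s * U $ b $ t)
      + G U * (U $ b $ p * U $ a $ q * U $ b $ s * U $ a $ t)
      + G U * (U $ a $ p * U $ b $ q * U $ b $ s * U $ a $ t)
      + G U * (U $ b $ p * U $ a $ q * U $ a $ s * U $ b $ t)) \<partial>M)"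
    unfolding F by (rule Bochner_Integration.integral_cong) (simp_all add: F_def algebra_simps)
  also have "\<dots> = 1/2 * (J a a a a + J b b b b + J a a b b + J b b a a + J a b a b + J b a b a
      + J a b b a + J b a a b)"
    unfolding integral_mult_right_zero J_def using int
    by (simp add: Bochner_Integration.integral_add Bochner_Integration.integrable_add)
  finally have *: "J a a a a + J b b b b = J a a b b + J b b a a + J a b a b + J b a b a + J a b b a + J b a a b"
    by simp
  define \<sigma> where "\<sigma> e = (if e = a then b else if e = b then a else e)" for e
  have swap: "J (\<sigma> e) (\<sigma> f) (\<sigma> g) (\<sigma> h) = J e f g h" for e f g h
  proof -
    have "tame (\<lambda>U. U $ e $ p * U $ f $ q * U $ g $ s * U $ h $ t)" by (intro tame_mult tame_entry)
    from integral_swap_rows[OF ab G this]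
    have "(\<integral>U. G U * ((row_reflection a b 0 1 ** U) $ e $ p * (row_reflection a b 0 1 ** U) $ f $ q *
        (row_reflection a b 0 1 ** U) $ g $ s * (row_reflection a b 0 1 ** U) $ h $ t) \<partial>M) = J e f g h"
      by (simp add: J_def)
    moreover have "(row_reflection a b 0 1 ** U) $ x $ y = U $ \<sigma> x $ y"
      for U :: "real ^ 'n ^ 'n" and x y
      using ab by (auto simp: row_reflection_mult \<sigma>_def)
    ultimately show ?thesis by (simp add: J_def)
  qed
  \<comment> \<open>The swap pairs off the eight integrals, so \<open>*\<close> is twice the wanted
    identity.\<close>
  have "J b b b b = J a a a a" "J b b a a = J a a b b" "J b a b a = J a b a b" "J a b b a = J b a a b"
    using swap[of a a a a] swap[of a a b b] swap[of a b a b] swap[of b a a b] ab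
    by (simp_all add: \<sigma>_def)
  with * have "J a a a a = J a a b b + J b a a b + J a b a b" by simp
  \<comment> \<open>In all three integrals \<open>t\<close> stays in row \<open>b\<close>, while
    \<open>s\<close> also lies in row \<open>b\<close> or trades places with \<open>p\<close> or
    \<open>q\<close>: these become the identity and the two transpositions with
    \<open>2*n+1\<close>.\<close>
  then show ?thesis by (simp add: J_def mult_ac)
qed

lemma prod_row_reflection:
  assumes "a \<noteq> b" "\<And>r. r \<in> A \<Longrightarrow> i r \<noteq> a \<and> i r \<noteq> b"
  shows "(\<Prod>r\<in>A. (row_reflection a b c s ** U) $ i r $ j r) = (\<Prod>r\<in>A. U $ i r $ j r)"
  using assms by (intro prod.cong) (auto simp: row_reflection_mult)

text \<open>The pattern of \<open>i\<close> says which rows coincide. The columns may be any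
  \<open>j\<close>: the reduction to \<open>Wg_O M n i j\<close> is decided by an equality of
  values.\<close>

lemma Wg_O_recursion:
  assumes "index_pattern (Suc n) i (trivial_pairing (Suc n))"
  shows "real CARD('n) * Wg_O M (Suc n) i j
      + (\<Sum>t\<in>{1..2*n}. Wg_O M (Suc n) i (j \<circ> Transposition.transpose t (2*n+1)))
    = (if j (2*n+1) = j (2*n+2) then Wg_O M n i j else 0)"
proof -
  have i_eq: "i (2*r-1) = i (2*r)" if "r \<in> {1..Suc n}" for r
  proof -
    have "{2*r-1, 2*r} \<in> trivial_pairing (Suc n)"
      using that unfolding trivial_pairing_def by blast
    moreover have "2*r-1 \<in> {1..2*Suc n}" "2*r \<in> {1..2*Suc n}" "2*r-1 \<noteq> 2*r" using that by auto
    ultimately show ?thesis using assms unfolding index_pattern_def by blast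
  qed
  \<comment> \<open>Even positions serve as representatives of the rows: a block of the trivial
    pairing contains an odd and an even number.\<close>
  have i_neq: "i (2*r) \<noteq> i (2*r')" if "r \<in> {1..Suc n}" "r' \<in> {1..Suc n}" "r \<noteq> r'" for r r'
  proof
    assume eq: "i (2*r) = i (2*r')"
    have "{2*r, 2*r'} \<in> trivial_pairing (Suc n)"
      using assms that eq unfolding index_pattern_def by auto
    with that obtain t where "t \<in> {1..Suc n}"
        "2*r = 2*t-1 \<and> 2*r' = 2*t \<or> 2*r = 2*t \<and> 2*r' = 2*t-1"
      by (auto simp: trivial_pairing_mem_iff)
    then show False by (auto; presburger)
  qed
  define b where "b = i (2*n+2)"
  have b': "i (2*n+1) = b" using i_eq[of "Suc n"] by (simp add: b_def)
  have i_half: "\<exists>r\<in>{1..n}. i x = i (2*r) \<and> (x = 2*r-1 \<or> x = 2*r)" if "x \<in> {1..2*n}" for x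
  proof (cases "even x")
    case True
    then obtain r where "x = 2 * r" by blast
    with that show ?thesis by (intro bexI[of _ r]) auto
  next
    case False
    then obtain r where r: "x = 2 * r + 1" using oddE by blast
    with that i_eq[of "Suc r"] show ?thesis by (intro bexI[of _ "Suc r"]) auto
  qed
  have i_ne_b: "i x \<noteq> b" if "x \<in> {1..2*n}" for x
  proof -
    from i_half[OF that] obtain r where "r \<in> {1..n}" "i x = i (2*r)" by blast
    then show ?thesis using i_neq[of r "Suc n"] by (simp add: b_def)
  qed
  define G where "G U = (\<Prod>r\<in>{1..2*n}. U $ i r $ j r)" for U :: "real ^ 'n ^ 'n"
  define p where "p = j (2*n+1)"
  define q where "q = j (2*n+2)"
  \<comment> \<open>\<open>T a\<close> moves the last two factors into row \<open>a\<close>, so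
    \<open>T b\<close> is the integral wanted. The sum over all rows is computed twice: by
    orthonormality of columns \<open>p\<close> and \<open>q\<close>, and row by row.\<close>
  define T where "T a = (\<integral>U. G U * (U $ a $ p * U $ a $ q) \<partial>M)" for a
  define W where "W = Wg_O M (Suc n) i"
  have split: "{1..2 * Suc n} = insert (2*n+1) (insert (2*n+2) {1..2*n})" by auto
  have W: "W j' = (\<integral>U. (\<Prod>r\<in>{1..2*n}. U $ i r $ j' r) * (U $ b $ j' (2*n+1) * U $ b $ j' (2*n+2)) \<partial>M)" for j'
    unfolding W_def Wg_O_def split using b' b_def by (simp add: mult_ac)
  have tG: "tame G" unfolding G_def by auto
  have "(\<Sum>a\<in>UNIV. T a) = (\<integral>U. (\<Sum>a\<in>UNIV. G U * (U $ a $ p * U $ a $ q)) \<partial>M)"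
    unfolding T_def
    by (intro Bochner_Integration.integral_sum[symmetric] tame_integrable tame_mult tame_entry tG)
  also have "\<dots> = (\<integral>U. G U * (if p = q then 1 else 0) \<partial>M)"
  proof (rule Bochner_Integration.integral_cong)
    fix U assume "U \<in> space M"
    then have "transpose U ** U = mat 1" by (simp add: space_M orthogonal_matrix_def)
    then have "(transpose U ** U) $ p $ q = (if p = q then 1 else 0)" by (simp add: mat_def)
    then have "(\<Sum>a\<in>UNIV. U $ a $ p * U $ a $ q) = (if p = q then 1 else 0)"
      by (simp add: matrix_matrix_mult_def transpose_def)
    then show "(\<Sum>a\<in>UNIV. G U * (U $ a $ p * U $ a $ q)) = G U * (if p = q then 1 else 0)"
      by (simp flip: sum_distrib_left)
  qed simp
  also have "\<dots> = (if p = q then Wg_O M n i j else 0)"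
    by (simp add: Wg_O_def G_def)
  finally have total: "(\<Sum>a\<in>UNIV. T a) = (if p = q then Wg_O M n i j else 0)" .
  have fresh: "T a = W j" if "a \<notin> i ` {1..2*n}" for a
  proof (cases "a = b")
    case True
    then show ?thesis by (simp add: W T_def G_def p_def q_def)
  next
    case False
    have GV: "G (row_reflection a b c s ** U) = G U" for c s U
      unfolding G_def using False that i_ne_b by (intro prod_row_reflection) auto
    have "tame (\<lambda>U. U $ b $ p * U $ b $ q)" by (intro tame_mult tame_entry)
    from integral_swap_rows[OF False tG GV this]
    show ?thesis using False by (simp add: W T_def G_def p_def q_def row_reflection_mult)
  qed
  \<comment> \<open>Taking the two factors of row \<open>a\<close> out of \<open>G\<close> leaves a
    product without rows \<open>a\<close> and \<open>b\<close>, next to four factors in row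
    \<open>a\<close>.\<close>
  have old: "T (i (2*r)) = W j + (W (j \<circ> Transposition.transpose (2*r-1) (2*n+1))
      + W (j \<circ> Transposition.transpose (2*r) (2*n+1)))" if r: "r \<in> {1..n}" for r
  proof -
    define a where "a = i (2*r)"
    have ab: "a \<noteq> b" using r i_ne_b[of "2*r"] by (auto simp: a_def)
    define A where "A = {1..2*n} - {2*r-1, 2*r}"
    have A: "{1..2*n} = insert (2*r-1) (insert (2*r) A)" using r by (auto simp: A_def)
    have A': "finite A" "2*r-1 \<notin> A" "2*r \<notin> A" "2*r-1 \<noteq> 2*r" using r by (auto simp: A_def)
    have ia: "i (2*r-1) = a" using i_eq[of r] r by (simp add: a_def)
    define G' where "G' U = (\<Prod>x\<in>A. U $ i x $ j x)" for U :: "real ^ 'n ^ 'n"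
    have tG': "tame G'" unfolding G'_def by auto
    have GV: "G' (row_reflection a b c s ** U) = G' U" for c s U
    proof -
      have "i x \<noteq> a" if "x \<in> A" for x
      proof -
        from that obtain r' where r': "r' \<in> {1..n}" "i x = i (2*r')" "x = 2*r'-1 \<or> x = 2*r'"
          using i_half[of x] by (auto simp: A_def)
        moreover from this that have "r' \<noteq> r" by (auto simp: A_def)
        ultimately show ?thesis using i_neq[of r' r] r by (auto simp: a_def)
      qed
      then show ?thesis
        unfolding G'_def using ab i_ne_b by (intro prod_row_reflection) (auto simp: A_def)
    qed
    have G: "(\<Prod>x\<in>{1..2*n}. U $ i x $ j' x) =
        (\<Prod>x\<in>A. U $ i x $ j' x) * (U $ a $ j' (2*r-1) * U $ a $ j' (2*r))" for U :: "real ^ 'n ^ 'n" and j'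
      unfolding A using A' ia by (simp add: a_def mult_ac)
    have "T a = (\<integral>U. G' U * (U $ a $ j (2*r-1) * U $ a $ j (2*r) * U $ a $ p * U $ a $ q) \<partial>M)"
      unfolding T_def G_def G G'_def by (simp add: mult_ac)
    also note integral_four_in_row[OF ab tG' GV]
    also have "(\<integral>U. G' U * (U $ a $ j (2*r-1) * U $ a $ j (2*r) * U $ b $ p * U $ b $ q) \<partial>M) = W j"
      unfolding W G G'_def by (simp add: mult_ac p_def q_def)
    also have "(\<integral>U. G' U * (U $ a $ p * U $ a $ j (2*r) * U $ b $ j (2*r-1) * U $ b $ q) \<partial>M)
        = W (j \<circ> Transposition.transpose (2*r-1) (2*n+1))"
    proof -
      let ?j = "j \<circ> Transposition.transpose (2*r-1) (2*n+1)"
      have "(\<Prod>x\<in>A. U $ i x $ ?j x) = G' U" for U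
        unfolding G'_def by (intro prod.cong) (auto simp: A_def transpose_def)
      moreover have "?j (2*r-1) = p" "?j (2*r) = j (2*r)" "?j (2*n+1) = j (2*r-1)" "?j (2*n+2) = q"
        using r by (auto simp: transpose_def p_def q_def)
      ultimately show ?thesis unfolding W G by (simp add: mult_ac)
    qed
    also have "(\<integral>U. G' U * (U $ a $ j (2*r-1) * U $ a $ p * U $ b $ j (2*r) * U $ b $ q) \<partial>M)
        = W (j \<circ> Transposition.transpose (2*r) (2*n+1))"
    proof -
      let ?j = "j \<circ> Transposition.transpose (2*r) (2*n+1)"
      have "(\<Prod>x\<in>A. U $ i x $ ?j x) = G' U" for U
        unfolding G'_def by (intro prod.cong) (auto simp: A_def transpose_def)
      moreover have "?j (2*r-1) = j (2*r-1)" "?j (2*r) = p" "?j (2*n+1) = j (2*r)" "?j (2*n+2) = q"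
        using r by (auto simp: transpose_def p_def q_def)
      ultimately show ?thesis unfolding W G by (simp add: mult_ac)
    qed
    finally show ?thesis by (simp only: a_def add.assoc)
  qed
  define I where "I = (\<lambda>r. i (2*r)) ` {1..n}"
  have inj: "inj_on (\<lambda>r. i (2*r)) {1..n}"
  proof (rule inj_onI)
    fix x y assume "x \<in> {1..n}" "y \<in> {1..n}" "i (2*x) = i (2*y)"
    then show "x = y" using i_neq[of x y] by (cases "x = y") auto
  qed
  have I: "i ` {1..2*n} = I" using i_half by (force simp: I_def)
  have cardI: "card I = n" using card_image[OF inj] by (simp add: I_def)
  have cardC: "card (UNIV - I) = CARD('n) - n"
    using cardI by (simp add: card_Diff_subset)
  have le: "n \<le> CARD('n)" unfolding cardI[symmetric] by (rule card_mono) auto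
  \<comment> \<open>The \<open>d - n\<close> new rows give one \<open>W j\<close> each, and so does
    each of the \<open>n\<close> old rows, which completes the coefficient to \<open>d\<close>. The
    remaining contributions of the old rows run over all \<open>2*n\<close> transpositions.\<close>
  have "(\<Sum>a\<in>UNIV. T a) = (\<Sum>a\<in>UNIV - I. T a) + (\<Sum>a\<in>I. T a)"
    by (rule sum.subset_diff) auto
  also have "(\<Sum>a\<in>UNIV - I. T a) = (\<Sum>a\<in>UNIV - I. W j)"
    using fresh I by (intro sum.cong) auto
  also have "\<dots> = (real CARD('n) - real n) * W j" using cardC le by (simp add: of_nat_diff)
  also have "(\<Sum>a\<in>I. T a) = (\<Sum>r\<in>{1..n}. T (i (2*r)))"
    unfolding I_def by (rule sum.reindex[OF inj, unfolded o_def])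
  also have "\<dots> = (\<Sum>r\<in>{1..n}. W j + (W (j \<circ> Transposition.transpose (2*r-1) (2*n+1))
      + W (j \<circ> Transposition.transpose (2*r) (2*n+1))))"
    using old by (rule sum.cong[OF refl])
  also have "\<dots> = real n * W j + (\<Sum>t\<in>{1..2*n}. W (j \<circ> Transposition.transpose t (2*n+1)))"
    unfolding sum_pairs by (simp add: sum.distrib)
  finally show ?thesis using total by (simp add: W_def p_def q_def algebra_simps)
qed

lemma Wg_O_0 [simp]: "Wg_O M 0 i j = 1"
  by (simp add: Wg_O_def prob_space)

text \<open>The a priori bound behind uniqueness: a solution of the recursion that is bounded
  uniformly in the indices is determined by contraction.\<close>

lemma abs_Wg_O_le_1: "\<bar>Wg_O M k i j\<bar> \<le> 1"
proof -
  have int: "integrable M (\<lambda>U. \<Prod>r\<in>{1..2*k}. U $ i r $ j r)"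
    by (intro tame_integrable) auto
  have "\<bar>\<Prod>r\<in>{1..2*k}. U $ i r $ j r\<bar> \<le> 1" if "U \<in> space M" for U
    unfolding abs_prod using abs_entry_le_1[OF that] by (intro prod_le_1) auto
  then have "AE U in M. (\<Prod>r\<in>{1..2*k}. U $ i r $ j r) \<le> 1"
    "AE U in M. - 1 \<le> (\<Prod>r\<in>{1..2*k}. U $ i r $ j r)"
    by (auto intro!: AE_I2 simp: abs_le_iff)
  from integral_le_const[OF int this(1)] integral_ge_const[OF int this(2)]
  show ?thesis by (simp add: Wg_O_def abs_le_iff)
qed

end

section \<open>Catalan numbers\<close>

text \<open>For \<open>n >= 1\<close> this is the Catalan number with index \<open>n - 1\<close>,
  the coefficient of \<open>z^n\<close> in \<open>(1 - sqrt (1 - 4 z)) / 2\<close>. The value at 0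
  is \<open>-1/2\<close>, that of \<open>- sqrt (1 - 4 z) / 2\<close>.\<close>

definition shifted_catalan :: "nat \<Rightarrow> real" where
  "shifted_catalan n = - ((1/2) gchoose n) * (-4) ^ n / 2"

lemma shifted_catalan_1 [simp]: "shifted_catalan (Suc 0) = 1"
  by (simp add: shifted_catalan_def)

text \<open>Squaring \<open>sqrt (1 - 4 z)\<close> leaves no coefficients from degree 2 on; this is
  Vandermonde's identity for \<open>1/2 + 1/2 = 1\<close>. The end terms \<open>s = 0\<close> and
  \<open>s = n\<close> of the vanishing sum supply the right-hand side.\<close>

lemma shifted_catalan_convolution:
  assumes "2 \<le> n"
  shows "(\<Sum>s=1..<n. shifted_catalan s * shifted_catalan (n - s)) = shifted_catalan n"
proof -
  define u :: "nat \<Rightarrow> real" where "u n = ((1/2) gchoose n) * (-4) ^ n" for n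
  have u: "u n = - 2 * shifted_catalan n" for n by (simp add: u_def shifted_catalan_def)
  have "(\<Sum>s=0..n. u s * u (n - s)) =
      (\<Sum>s=0..n. (((1/2) gchoose s) * ((1/2) gchoose (n - s))) * (-4) ^ n)"
  proof (rule sum.cong)
    fix s assume "s \<in> {0..n}"
    then have "(-4::real) ^ n = (-4) ^ s * (-4) ^ (n - s)"
      by (simp flip: power_add)
    then show "u s * u (n - s) = (((1/2) gchoose s) * ((1/2) gchoose (n - s))) * (-4) ^ n"
      by (simp add: u_def)
  qed simp
  also have "\<dots> = ((1/2 + 1/2 :: real) gchoose n) * (-4) ^ n"
    by (simp only: gbinomial_Vandermonde flip: sum_distrib_right)
  also have "\<dots> = 0"
  proof -
    have "((1::real) gchoose n) = of_nat (1 choose n)" by (metis binomial_gbinomial of_nat_1)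
    also have "\<dots> = 0" using assms by (simp add: binomial_eq_0)
    finally show ?thesis by simp
  qed
  finally have 1: "(\<Sum>s=0..n. u s * u (n - s)) = 0" .
  have "{0..n} = insert 0 (insert n {1..<n})" using assms by auto
  then have "(\<Sum>s=0..n. u s * u (n - s)) = 2 * u n * u 0 + (\<Sum>s=1..<n. u s * u (n - s))"
    using assms by simp
  with 1 have "2 * u n + (\<Sum>s=1..<n. u s * u (n - s)) = 0" by (simp add: u_def)
  moreover have "(\<Sum>s=1..<n. u s * u (n - s)) =
      4 * (\<Sum>s=1..<n. shifted_catalan s * shifted_catalan (n - s))"
    by (simp add: u sum_distrib_left mult.assoc)
  ultimately show ?thesis by (simp add: u)
qed

lemma shifted_catalan_Suc:
  "real (Suc n) * shifted_catalan (Suc n) = (4 * real n - 2) * shifted_catalan n"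
proof -
  have "of_nat (Suc n) * ((1/2 :: real) gchoose (Suc n)) = (1/2 - of_nat n) * ((1/2) gchoose n)"
    using gbinomial_absorb_comp[of "1/2 :: real" n] gbinomial_absorption[of n "1/2 :: real"] by simp
  then have "(of_nat (Suc n) * ((1/2 :: real) gchoose (Suc n))) * (-4) ^ Suc n / 2 =
      ((1/2 - of_nat n) * ((1/2) gchoose n)) * (-4) ^ Suc n / 2"
    by (rule arg_cong)
  then show ?thesis by (simp add: shifted_catalan_def algebra_simps del: of_nat_Suc)
qed

lemma shifted_catalan_pos: "n \<ge> 1 \<Longrightarrow> 0 < shifted_catalan n"
proof (induction n rule: nat_induct_at_least)
  case (Suc n)
  then have "0 < real (Suc n) * shifted_catalan (Suc n)"
    unfolding shifted_catalan_Suc by simp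
  then show ?case by (simp add: zero_less_mult_iff)
qed simp

lemma shifted_catalan_le: "n \<ge> 1 \<Longrightarrow> shifted_catalan n \<le> 4 ^ (n - 1)"
proof (induction n rule: nat_induct_at_least)
  case (Suc n)
  have "real (Suc n) * shifted_catalan (Suc n) \<le> real (Suc n) * (4 * shifted_catalan n)"
    unfolding shifted_catalan_Suc using shifted_catalan_pos[OF Suc.hyps] by (simp add: algebra_simps)
  then have "shifted_catalan (Suc n) \<le> 4 * shifted_catalan n" by simp
  also have "\<dots> \<le> 4 * 4 ^ (n - 1)" using Suc.IH by simp
  also have "\<dots> = 4 ^ (Suc n - 1)" using Suc.hyps by (cases n) auto
  finally show ?case .
qed simp

text \<open>With the upper bound \<open>4^(n-1)\<close> this fixes the Catalan numbers up to a
  polynomial factor, which is all that merging requires. The square makes the induction work, since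
  \<open>4 n^2 \<le> (n + 1) (4 n - 2)\<close> for \<open>n >= 1\<close>.\<close>

lemma shifted_catalan_ge: "n \<ge> 1 \<Longrightarrow> 4 ^ (n - 1) \<le> (real n)\<^sup>2 * shifted_catalan n"
proof (induction n rule: nat_induct_at_least)
  case (Suc n)
  have "4 ^ (Suc n - 1) = 4 * (4::real) ^ (n - 1)" using Suc.hyps by (cases n) auto
  also have "\<dots> \<le> 4 * (real n)\<^sup>2 * shifted_catalan n" using Suc.IH by simp
  also have "\<dots> \<le> real (Suc n) * (4 * real n - 2) * shifted_catalan n"
    using Suc.hyps shifted_catalan_pos[OF Suc.hyps]
    by (intro mult_right_mono) (auto simp: power2_eq_square algebra_simps)
  also have "\<dots> = (real (Suc n))\<^sup>2 * shifted_catalan (Suc n)"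
    using shifted_catalan_Suc[of n] by (simp add: power2_eq_square)
  finally show ?case .
qed simp

text \<open>The factor 4 is the surplus in \<open>a + b - 1 = 1 + (a - 1) + (b - 1)\<close>, and
  each of the two lower bounds contributes \<open>K^2\<close>.\<close>

lemma shifted_catalan_add_le:
  assumes "a \<ge> 1" "b \<ge> 1" "a \<le> K" "b \<le> K"
  shows "shifted_catalan (a + b) \<le> 4 * real K ^ 4 * (shifted_catalan a * shifted_catalan b)"
proof -
  have pos: "0 < shifted_catalan a" "0 < shifted_catalan b"
    using assms shifted_catalan_pos by auto
  have "(4::real) ^ (a + b - 1) = 4 * (4 ^ (a - 1) * 4 ^ (b - 1))"
    using assms by (cases a; cases b) (auto simp: power_add)
  then have "shifted_catalan (a + b) \<le> 4 * (4 ^ (a - 1) * 4 ^ (b - 1))"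
    using shifted_catalan_le[of "a + b"] assms by simp
  also have "\<dots> \<le> 4 * (((real a)\<^sup>2 * shifted_catalan a) * ((real b)\<^sup>2 * shifted_catalan b))"
    using assms pos by (intro mult_left_mono mult_mono shifted_catalan_ge) auto
  also have "\<dots> \<le> 4 * (((real K)\<^sup>2 * shifted_catalan a) * ((real K)\<^sup>2 * shifted_catalan b))"
    using assms pos by (intro mult_left_mono mult_mono mult_right_mono power_mono) auto
  finally show ?thesis by (simp add: power2_eq_square power4_eq_xxxx algebra_simps)
qed

section \<open>Pairings and their components\<close>

definition pairing_on :: "'a set \<Rightarrow> 'a set set \<Rightarrow> bool" where
  "pairing_on S m \<longleftrightarrow> partition_on S m \<and> (\<forall>b\<in>m. card b = 2)"

text \<open>The value \<open>y\<close> outside the pairing makes \<open>mate m\<close> an involution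
  of the whole type, hence injective, as the orbit argument for cycles requires.\<close>

definition mate :: "'a set set \<Rightarrow> 'a \<Rightarrow> 'a" where
  "mate m y = (if y \<in> \<Union>m then THE z. {y, z} \<in> m else y)"

lemma pairing_on_neq: "pairing_on S m \<Longrightarrow> {y, z} \<in> m \<Longrightarrow> y \<noteq> z"
  by (auto simp: pairing_on_def)

lemma pairing_on_subset: "pairing_on S m \<Longrightarrow> b \<in> m \<Longrightarrow> b \<subseteq> S"
  by (auto simp: pairing_on_def partition_on_def)

lemma pairing_on_unique:
  assumes "pairing_on S m" "{y, z} \<in> m" "{y, z'} \<in> m"
  shows "z = z'"
proof -
  have "disjoint m" using assms(1) by (auto simp: pairing_on_def partition_on_def)
  then have "{y, z} = {y, z'}" using assms(2,3) by (metis disjointD IntI empty_iff insertI1)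
  then show ?thesis by (auto simp: doubleton_eq_iff)
qed

lemma pairing_on_ex:
  assumes "pairing_on S m" "y \<in> S"
  shows "\<exists>z. {y, z} \<in> m"
proof -
  obtain b where b: "b \<in> m" "y \<in> b"
    using assms by (auto simp: pairing_on_def partition_on_def)
  then have "card b = 2" using assms by (auto simp: pairing_on_def)
  with b show ?thesis by (auto simp: card_2_iff) (metis insert_commute)+
qed

lemma mate_eq:
  assumes "pairing_on S m" "{y, z} \<in> m"
  shows "mate m y = z"
proof -
  have "y \<in> \<Union>m" using assms(2) by blast
  moreover have "(THE z. {y, z} \<in> m) = z"
    using assms pairing_on_unique[OF assms(1)] by (intro the_equality) auto
  ultimately show ?thesis by (simp add: mate_def)
qed

lemma mate_edge: "pairing_on S m \<Longrightarrow> y \<in> S \<Longrightarrow> {y, mate m y} \<in> m"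
  using pairing_on_ex mate_eq by metis

lemma mate_in: "pairing_on S m \<Longrightarrow> y \<in> S \<Longrightarrow> mate m y \<in> S"
  using mate_edge pairing_on_subset by fastforce

lemma mate_outside: "pairing_on S m \<Longrightarrow> y \<notin> S \<Longrightarrow> mate m y = y"
  by (auto simp: mate_def pairing_on_def partition_on_def)

lemma mate_mate: "pairing_on S m \<Longrightarrow> mate m (mate m y) = y"
  by (metis insert_commute mate_edge mate_eq mate_outside)

lemma mate_neq: "pairing_on S m \<Longrightarrow> y \<in> S \<Longrightarrow> mate m y \<noteq> y"
  by (metis mate_edge pairing_on_neq)

section \<open>Connected components as closed and linked sets\<close>

definition pair_graph :: "'a set set \<Rightarrow> 'a set set \<Rightarrow> ('a \<times> 'a) set" where
  "pair_graph e m = {(x, y). {x, y} \<in> e \<union> m}"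

definition closed_under :: "('a \<times> 'a) set \<Rightarrow> 'a set \<Rightarrow> bool" where
  "closed_under r D \<longleftrightarrow> (\<forall>y\<in>D. \<forall>z. (y, z) \<in> r \<longrightarrow> z \<in> D)"

text \<open>The connecting walk may leave \<open>D\<close>; it cannot if \<open>D\<close> is also
  \<open>closed_under\<close> the relation.\<close>

definition linked_by :: "('a \<times> 'a) set \<Rightarrow> 'a set \<Rightarrow> bool" where
  "linked_by r D \<longleftrightarrow> (\<forall>y\<in>D. \<forall>z\<in>D. (y, z) \<in> r\<^sup>*)"

lemma sym_pair_graph: "sym (pair_graph e m)"
  by (auto simp: pair_graph_def sym_def insert_commute)

lemma closed_under_rtrancl:
  assumes "closed_under r D" "y \<in> D" "(y, z) \<in> r\<^sup>*"
  shows "z \<in> D"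
  using assms(3,2) assms(1) by (induction rule: rtrancl_induct) (auto simp: closed_under_def)

lemma closed_under_Diff: "sym r \<Longrightarrow> closed_under r C \<Longrightarrow> closed_under r A \<Longrightarrow> closed_under r (C - A)"
  unfolding closed_under_def by (meson DiffD1 DiffD2 DiffI symD)

lemma closed_under_Un: "closed_under r C \<Longrightarrow> closed_under r A \<Longrightarrow> closed_under r (C \<union> A)"
  unfolding closed_under_def by blast

lemma linked_by_Un:
  assumes "sym r" "linked_by r A" "linked_by r B" "y \<in> A" "z \<in> B" "(y, z) \<in> r"
  shows "linked_by r (A \<union> B)"
proof -
  have "(a, b) \<in> r\<^sup>*" if "a \<in> A" "b \<in> B" for a b
    using that assms unfolding linked_by_def by (meson rtrancl.rtrancl_into_rtrancl rtrancl_trans)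
  then show ?thesis
    using assms(2,3) symD[OF sym_rtrancl[OF assms(1)]] unfolding linked_by_def by blast
qed

text \<open>The criterion by which components are computed: once a partition into closed and linked
  sets is exhibited, no reflexive transitive closure has to be evaluated.\<close>

lemma quotient_eqI:
  assumes P: "partition_on S P" and D: "\<And>D. D \<in> P \<Longrightarrow> closed_under r D \<and> linked_by r D"
  shows "S // r\<^sup>* = P"
proof -
  have 1: "r\<^sup>* `` {y} = D" if "D \<in> P" "y \<in> D" for y D
    using D[OF that(1)] that(2) closed_under_rtrancl[of r D y] by (auto simp: linked_by_def)
  have "S = \<Union>P" "{} \<notin> P" using P by (auto simp: partition_on_def)
  then have "S // r\<^sup>* = (\<Union>D\<in>P. \<Union>y\<in>D. {r\<^sup>* `` {y}})" by (auto simp: quotient_def)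
  also have "\<dots> = (\<Union>D\<in>P. \<Union>y\<in>D. {D})" using 1 by simp
  also have "\<dots> = P" using \<open>{} \<notin> P\<close> by auto
  finally show ?thesis .
qed

lemma quotient_partition:
  assumes "sym r" "closed_under r S"
  shows "partition_on S (S // r\<^sup>*)"
    and "\<And>D. D \<in> S // r\<^sup>* \<Longrightarrow> closed_under r D \<and> linked_by r D"
proof -
  have s: "(z, y) \<in> r\<^sup>*" if "(y, z) \<in> r\<^sup>*" for y z
    using that symD[OF sym_rtrancl[OF assms(1)]] by blast
  show "partition_on S (S // r\<^sup>*)"
  proof (rule partition_onI)
    show "\<Union> (S // r\<^sup>*) = S" using closed_under_rtrancl[OF assms(2)] by (auto simp: quotient_def)
    fix D D' assume "D \<in> S // r\<^sup>*" "D' \<in> S // r\<^sup>*" "D \<noteq> D'"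
    then show "disjnt D D'"
      unfolding quotient_def disjnt_def by (auto, (meson s rtrancl_trans)+)
  qed (auto simp: quotient_def)
  show "closed_under r D \<and> linked_by r D" if "D \<in> S // r\<^sup>*" for D
    using that unfolding quotient_def closed_under_def linked_by_def
    by (auto intro: rtrancl_trans s)
qed

lemma linked_by_segment:
  assumes "sym r" "\<And>t. l \<le> t \<Longrightarrow> t < u \<Longrightarrow> (v t, v (Suc t)) \<in> r"
  shows "linked_by r (v ` {l..u})"
proof -
  have "t \<le> u \<Longrightarrow> (v l, v t) \<in> r\<^sup>*" if "l \<le> t" for t
    using that
    by (induction t rule: dec_induct) (auto intro: rtrancl_into_rtrancl[OF _ assms(2)])
  then have "(v l, y) \<in> r\<^sup>*" if "y \<in> v ` {l..u}" for y using that by auto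
  then show ?thesis
    unfolding linked_by_def using symD[OF sym_rtrancl[OF assms(1)]] by (meson rtrancl_trans)
qed

section \<open>Alternating cycles\<close>

definition alternating_cycle :: "'a set set \<Rightarrow> 'a set set \<Rightarrow> (nat \<Rightarrow> 'a) \<Rightarrow> nat \<Rightarrow> bool" where
  "alternating_cycle e m v a \<longleftrightarrow> 0 < a \<and> (\<forall>t. v (t + 2 * a) = v t) \<and> inj_on v {..<2 * a} \<and>
     (\<forall>s. {v (2 * s), v (2 * s + 1)} \<in> m) \<and> (\<forall>s. {v (2 * s + 1), v (2 * s + 2)} \<in> e)"

text \<open>Following the \<open>m\<close>-edge and then the \<open>e\<close>-edge is an injective
  map \<open>\<phi>\<close>; its orbit through \<open>x\<close> gives the even positions of the
  cycle and their \<open>m\<close>-mates the odd ones. The period \<open>a\<close> of the orbit is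
  half the length of the cycle, that is, a part of the coset-type.\<close>

lemma alternating_cycle_ex:
  assumes "finite S" and e: "pairing_on S e" and m: "pairing_on S m" and x: "x \<in> S"
  obtains v a where "alternating_cycle e m v a" "v 0 = x"
proof -
  define \<phi> where "\<phi> y = mate e (mate m y)" for y
  have inS: "(\<phi> ^^ n) y \<in> S" if "y \<in> S" for n y
    using that by (induction n) (auto simp: \<phi>_def intro: mate_in[OF e] mate_in[OF m])
  have inj: "inj \<phi>" by (rule injI) (metis \<phi>_def mate_mate e m)
  have "finite {y. \<exists>n. y = (\<phi> ^^ n) x}"
    by (rule finite_subset[OF _ assms(1)]) (auto intro: inS x)
  then obtain n where "0 < n" "(\<phi> ^^ n) x = x" using funpow_inj_finite[OF inj] by blast
  then have ex: "\<exists>n. 0 < n \<and> (\<phi> ^^ n) x = x" by blast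
  define a where "a = (LEAST n. 0 < n \<and> (\<phi> ^^ n) x = x)"
  have a: "0 < a" "(\<phi> ^^ a) x = x" using LeastI_ex[OF ex] by (auto simp: a_def)
  have least: "(\<phi> ^^ n) x \<noteq> x" if "0 < n" "n < a" for n
    using not_less_Least[of n] that by (auto simp: a_def)
  \<comment> \<open>If the \<open>m\<close>-mate of \<open>y\<close> is \<open>n + 2\<close> steps
    ahead of \<open>y\<close>, undoing one step at each end puts the \<open>m\<close>-mate of
    \<open>\<phi> y\<close> only \<open>n\<close> steps ahead of \<open>\<phi> y\<close>. The
    descent by two ends in a fixed point of \<open>mate m\<close> or of
    \<open>mate e\<close>.\<close>
  have no: "mate m y \<noteq> (\<phi> ^^ n) y" if "y \<in> S" for n y
    using that
  proof (induction n arbitrary: y rule: induct_nat_012)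
    case 0
    then show ?case using mate_neq[OF m] by simp
  next
    case 1
    then show ?case using mate_neq[OF e mate_in[OF m]] by (simp add: \<phi>_def) metis
  next
    case (ge2 n)
    show ?case
    proof
      assume "mate m y = (\<phi> ^^ Suc (Suc n)) y"
      also have "\<dots> = \<phi> ((\<phi> ^^ n) (\<phi> y))" by (simp add: funpow_swap1)
      finally have "mate m (mate e (mate m y)) = (\<phi> ^^ n) (\<phi> y)"
        by (metis \<phi>_def mate_mate e m)
      then have "mate m (\<phi> y) = (\<phi> ^^ n) (\<phi> y)" by (simp add: \<phi>_def)
      with ge2.IH(1)[of "\<phi> y"] inS[of y 1] ge2.prems show False by simp
    qed
  qed
  define v where "v t = (if even t then (\<phi> ^^ (t div 2)) x else mate m ((\<phi> ^^ (t div 2)) x))" for t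
  have comp: "(\<phi> ^^ (p + q)) y = (\<phi> ^^ p) ((\<phi> ^^ q) y)" for p q y
    by (simp add: funpow_add)
  have inj_fun: "s = s'" if "(\<phi> ^^ s) x = (\<phi> ^^ s') x" "s < a" "s' < a" for s s'
    using that
  proof (induction s s' rule: linorder_wlog)
    case (le s s')
    then have "(\<phi> ^^ s) ((\<phi> ^^ (s' - s)) x) = (\<phi> ^^ s) x"
      using comp[of s "s' - s" x] by simp
    then have "(\<phi> ^^ (s' - s)) x = x" using inj_fn[OF inj, of s] by (simp add: inj_eq)
    moreover have "s' - s < a" using le.prems by linarith
    ultimately show ?case using least[of "s' - s"] le.hyps by (cases "s = s'") auto
  qed auto
  have no': "(\<phi> ^^ s) x \<noteq> mate m ((\<phi> ^^ s') x)" for s s'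
  proof (cases "s' \<le> s")
    case True
    then have "(\<phi> ^^ s) x = (\<phi> ^^ (s - s')) ((\<phi> ^^ s') x)"
      using comp[of "s - s'" s' x] by simp
    with no[OF inS[OF x], of s' "s - s'"] show ?thesis by metis
  next
    case False
    then have "(\<phi> ^^ s') x = (\<phi> ^^ (s' - s)) ((\<phi> ^^ s) x)"
      using comp[of "s' - s" s x] by simp
    with no[OF inS[OF x], of s "s' - s"] show ?thesis by (metis mate_mate m)
  qed
  have "inj_on v {..<2 * a}"
  proof (rule inj_onI)
    fix t t' assume t: "t \<in> {..<2 * a}" "t' \<in> {..<2 * a}" "v t = v t'"
    then have lt: "t div 2 < a" "t' div 2 < a" by auto
    have "even t = even t'"
      using t(3) no'[of "t div 2" "t' div 2"] no'[of "t' div 2" "t div 2"]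
      by (auto simp: v_def split: if_splits)
    moreover from this t(3) have "(\<phi> ^^ (t div 2)) x = (\<phi> ^^ (t' div 2)) x"
      by (auto simp: v_def split: if_splits) (metis mate_mate m)
    then have "t div 2 = t' div 2" using inj_fun lt by blast
    ultimately show "t = t'" by (metis even_two_times_div_two odd_two_times_div_two_succ)
  qed
  moreover have "v (t + 2 * a) = v t" for t
  proof -
    have "(\<phi> ^^ (a + t div 2)) x = (\<phi> ^^ (t div 2)) x"
      using comp[of "t div 2" a x] a(2) by (simp add: add.commute)
    then show ?thesis unfolding v_def by (simp add: add.commute)
  qed
  moreover have "{v (2 * s), v (2 * s + 1)} \<in> m" for s
    using mate_edge[OF m inS[OF x]] by (simp add: v_def)
  moreover have "{v (2 * s + 1), v (2 * s + 2)} \<in> e" for s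
    using mate_edge[OF e mate_in[OF m inS[OF x, of s]]] by (simp add: v_def \<phi>_def)
  ultimately have "alternating_cycle e m v a" using a(1) by (simp add: alternating_cycle_def)
  moreover have "v 0 = x" by (simp add: v_def)
  ultimately show ?thesis by (rule that)
qed

lemma mem_perm_act_transpose:
  "{y, z} \<in> perm_act (Transposition.transpose i x) m \<longleftrightarrow>
     {Transposition.transpose i x y, Transposition.transpose i x z} \<in> m"
proof -
  let ?\<tau> = "Transposition.transpose i x"
  have 1: "{y, z} = ?\<tau> ` {?\<tau> y, ?\<tau> z}" by simp
  have 2: "?\<tau> ` (?\<tau> ` b) = b" for b by (simp add: image_image)
  show ?thesis
  proof
    assume "{y, z} \<in> perm_act ?\<tau> m"
    then obtain b where "b \<in> m" "{y, z} = ?\<tau> ` b" by (auto simp: perm_act_def)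
    then have "?\<tau> ` {y, z} \<in> m" using 2 by simp
    then show "{?\<tau> y, ?\<tau> z} \<in> m" by simp
  next
    assume "{?\<tau> y, ?\<tau> z} \<in> m"
    then show "{y, z} \<in> perm_act ?\<tau> m" unfolding perm_act_def using 1 by blast
  qed
qed

lemma pairing_on_perm_act:
  assumes "pairing_on S m" "i \<in> S" "x \<in> S"
  shows "pairing_on S (perm_act (Transposition.transpose i x) m)"
proof -
  let ?\<tau> = "Transposition.transpose i x"
  have inj: "inj ?\<tau>" by (rule inj_on_inverseI[of _ ?\<tau>]) simp
  have S: "?\<tau> ` S = S" using assms by (auto simp: image_iff Transposition.transpose_def)
  have P: "partition_on S m" using assms by (simp add: pairing_on_def)
  have "partition_on (?\<tau> ` S) ((`) ?\<tau> ` m)"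
  proof (rule partition_onI)
    show "\<Union> ((`) ?\<tau> ` m) = ?\<tau> ` S" using P by (auto simp: partition_on_def)
    show "{} \<notin> (`) ?\<tau> ` m" using P by (auto simp: partition_on_def)
    fix p q assume "p \<in> (`) ?\<tau> ` m" "q \<in> (`) ?\<tau> ` m" "p \<noteq> q"
    then obtain b b' where b: "p = ?\<tau> ` b" "q = ?\<tau> ` b'" "b \<in> m" "b' \<in> m" "b \<noteq> b'" by blast
    then have "b \<inter> b' = {}" using P by (auto simp: partition_on_def disjoint_def)
    then have "?\<tau> ` b \<inter> ?\<tau> ` b' = {}" by (simp flip: image_Int[OF inj])
    then show "disjnt p q" by (simp add: disjnt_def b)
  qed
  moreover have "card (?\<tau> ` b) = card b" for b by (rule card_image) (use inj in \<open>auto intro: inj_on_subset\<close>)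
  ultimately show ?thesis
    using assms(1) S by (auto simp: pairing_on_def perm_act_def)
qed

definition pair_components :: "'a set \<Rightarrow> 'a set set \<Rightarrow> 'a set set \<Rightarrow> 'a set set" where
  "pair_components S e m = S // (pair_graph e m)\<^sup>*"

text \<open>In each pairing a vertex has just one neighbour, so finding it inside \<open>D\<close>
  rules out any edge that leaves.\<close>

lemma closed_under_pair_graph:
  assumes "pairing_on S e" "pairing_on S m"
    and "\<And>y. y \<in> D \<Longrightarrow> \<exists>z\<in>D. {y, z} \<in> e" "\<And>y. y \<in> D \<Longrightarrow> \<exists>z\<in>D. {y, z} \<in> m"
  shows "closed_under (pair_graph e m) D"
  unfolding closed_under_def
proof (intro ballI allI impI)
  fix y z assume y: "y \<in> D" and "(y, z) \<in> pair_graph e m"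
  then consider "{y, z} \<in> e" | "{y, z} \<in> m" by (auto simp: pair_graph_def)
  then show "z \<in> D"
  proof cases
    case 1
    with assms(3)[OF y] pairing_on_unique[OF assms(1)] show ?thesis by blast
  next
    case 2
    with assms(4)[OF y] pairing_on_unique[OF assms(2)] show ?thesis by blast
  qed
qed

lemma closed_under_pair_graph_UNIV:
  assumes "pairing_on S e" "pairing_on S m"
  shows "closed_under (pair_graph e m) S"
proof (rule closed_under_pair_graph[OF assms])
  fix y assume "y \<in> S"
  then show "\<exists>z\<in>S. {y, z} \<in> e" "\<exists>z\<in>S. {y, z} \<in> m"
    using assms mate_edge[OF _ \<open>y \<in> S\<close>] mate_in[OF _ \<open>y \<in> S\<close>] by blast+
qed

lemma pair_components_partition:
  assumes "pairing_on S e" "pairing_on S m"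
  shows "partition_on S (pair_components S e m)"
    and "D \<in> pair_components S e m \<Longrightarrow> closed_under (pair_graph e m) D"
    and "D \<in> pair_components S e m \<Longrightarrow> linked_by (pair_graph e m) D"
  unfolding pair_components_def
  using quotient_partition[OF sym_pair_graph closed_under_pair_graph_UNIV[OF assms]] by blast+

lemma finite_pair_components:
  assumes "finite S" "pairing_on S e" "pairing_on S m"
  shows "finite (pair_components S e m)"
  using finite_elements[OF assms(1) pair_components_partition(1)[OF assms(2,3)]] .

lemma card_pair_components_le:
  assumes "finite S" "pairing_on S e" "pairing_on S m"
  shows "2 * card (pair_components S e m) \<le> card S"
proof -
  note P = pair_components_partition[OF assms(2,3)]
  have 2: "2 \<le> card D" if D: "D \<in> pair_components S e m" for D
  proof -
    have "D \<noteq> {}" "D \<subseteq> S" using P(1) D by (auto simp: partition_on_def)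
    then obtain y where y: "y \<in> D" "y \<in> S" by blast
    have "(y, mate m y) \<in> pair_graph e m"
      using mate_edge[OF assms(3) y(2)] by (simp add: pair_graph_def)
    then have "mate m y \<in> D" using P(2)[OF D] y(1) by (auto simp: closed_under_def)
    moreover have "mate m y \<noteq> y" using mate_neq[OF assms(3) y(2)] .
    ultimately have "card {y, mate m y} = 2" "{y, mate m y} \<subseteq> D" using y by auto
    then show ?thesis using card_mono[of D "{y, mate m y}"] finite_subset[OF \<open>D \<subseteq> S\<close> assms(1)] by simp
  qed
  have "card S = (\<Sum>D\<in>pair_components S e m. card D)"
    using card_Union_disjoint[OF partition_onD2[OF P(1)]] finite_subset[OF _ assms(1)]
    by (simp flip: partition_onD1[OF P(1)]) (metis Sup_upper P(1) partition_onD1)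
  also have "\<dots> \<ge> (\<Sum>D\<in>pair_components S e m. 2)" by (rule sum_mono) (rule 2)
  finally show ?thesis by simp
qed

lemma in_partition_eqI: "partition_on S P \<Longrightarrow> A \<in> P \<Longrightarrow> B \<in> P \<Longrightarrow> A \<inter> B \<noteq> {} \<Longrightarrow> A = B"
  unfolding partition_on_def disjoint_def by blast

context
  fixes e m v a S
  assumes cyc: "alternating_cycle e m v a" and e: "pairing_on S e" and m: "pairing_on S m"
begin

lemma cycle_edge: "even t \<Longrightarrow> {v t, v (Suc t)} \<in> m" "odd t \<Longrightarrow> {v t, v (Suc t)} \<in> e"
proof -
  have *: "{v (2 * s), v (2 * s + 1)} \<in> m" "{v (2 * s + 1), v (2 * s + 2)} \<in> e" for s
    using cyc unfolding alternating_cycle_def by blast+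
  show "even t \<Longrightarrow> {v t, v (Suc t)} \<in> m" using *(1)[of "t div 2"] by simp
  show "odd t \<Longrightarrow> {v t, v (Suc t)} \<in> e" using *(2)[of "t div 2"] by simp
qed

lemma cycle_period: "v (2 * a) = v 0"
proof -
  have "\<forall>t. v (t + 2 * a) = v t" using cyc unfolding alternating_cycle_def by blast
  from this[rule_format, of 0] show ?thesis by simp
qed

lemma cycle_pos: "0 < a" using cyc by (simp add: alternating_cycle_def)

text \<open>The window \<open>{1..2*a}\<close> puts \<open>v 0\<close> at its end, as
  \<open>v (2*a)\<close>. The walk through it uses every edge of the cycle except the
  \<open>m\<close>-edge from \<open>v 0\<close> to \<open>v 1\<close>, the one that a transposition
  moving \<open>v 0\<close> can destroy there.\<close>

lemma cycle_eq_iff: "t \<in> {1..2*a} \<Longrightarrow> t' \<in> {1..2*a} \<Longrightarrow> v t = v t' \<longleftrightarrow> t = t'"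
proof -
  have *: "v t = v (t mod (2 * a))" if "t \<in> {1..2*a}" for t
    using that cycle_period by (cases "t = 2 * a") auto
  assume t: "t \<in> {1..2*a}" "t' \<in> {1..2*a}"
  have "inj_on v {..<2 * a}" using cyc by (simp add: alternating_cycle_def)
  then have "v (t mod (2 * a)) = v (t' mod (2 * a)) \<longleftrightarrow> t mod (2 * a) = t' mod (2 * a)"
    using cycle_pos by (intro inj_on_eq_iff) auto
  also have "\<dots> \<longleftrightarrow> t = t'"
    using t by (cases "t = 2 * a"; cases "t' = 2 * a") auto
  finally show ?thesis using *[OF t(1)] *[OF t(2)] by simp
qed

lemma cycle_inj: "inj_on v {1..2*a}"
  by (rule inj_onI) (simp only: cycle_eq_iff)

lemma cycle_closed: "closed_under (pair_graph e m) (v ` {1..2*a})"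
proof (rule closed_under_pair_graph[OF e m])
  fix y assume "y \<in> v ` {1..2*a}"
  then obtain t where t: "t \<in> {1..2*a}" "y = v t" by blast
  show "\<exists>z\<in>v ` {1..2*a}. {y, z} \<in> e"
  proof (cases "odd t")
    case True
    with t have "Suc t \<in> {1..2*a}" by (auto; presburger)
    with cycle_edge(2)[OF True] t show ?thesis by blast
  next
    case False
    with t have "t - 1 \<in> {1..2*a}" "odd (t - 1)" "Suc (t - 1) = t" by (auto; presburger)+
    with cycle_edge(2)[of "t - 1"] t show ?thesis by (metis image_eqI insert_commute)
  qed
  show "\<exists>z\<in>v ` {1..2*a}. {y, z} \<in> m"
  proof (cases "odd t")
    case True
    have 1: "v (t - 1) \<in> v ` {1..2*a}"
    proof (cases "t = 1")
      case True
      then show ?thesis using cycle_period cycle_pos by (auto intro!: image_eqI[of _ _ "2*a"])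
    next
      case False
      with t have "t - 1 \<in> {1..2*a}" by auto
      then show ?thesis by (rule imageI)
    qed
    have "even (t - 1)" "Suc (t - 1) = t" using True t by auto
    with cycle_edge(1)[of "t - 1"] t 1 show ?thesis by (metis insert_commute)
  next
    case False
    have "v (Suc t) \<in> v ` {1..2*a}"
    proof (cases "t = 2 * a")
      case True
      then have "v (Suc t) = v 1" using cyc unfolding alternating_cycle_def by (metis add.commute plus_1_eq_Suc)
      then show ?thesis using cycle_pos by auto
    qed (use t in auto)
    with cycle_edge(1)[of t] False t show ?thesis by auto
  qed
qed

lemma cycle_linked: "linked_by (pair_graph e m) (v ` {1..2*a})"
proof (rule linked_by_segment[OF sym_pair_graph])
  show "(v t, v (Suc t)) \<in> pair_graph e m" for t
    using cycle_edge[of t] by (cases "even t") (simp_all add: pair_graph_def)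
qed

lemma cycle_component: "v 0 \<in> S \<Longrightarrow> v ` {1..2*a} \<in> pair_components S e m"
proof -
  assume "v 0 \<in> S"
  have "v 0 \<in> v ` {1..2*a}" using cycle_period cycle_pos by (auto intro!: image_eqI[of _ _ "2*a"])
  then have "(pair_graph e m)\<^sup>* `` {v 0} = v ` {1..2*a}"
    using closed_under_rtrancl[OF cycle_closed] cycle_linked by (auto simp: linked_by_def)
  then show ?thesis unfolding pair_components_def using \<open>v 0 \<in> S\<close> by (metis quotientI)
qed

end

lemma pair_graphI: "{y, z} \<in> e \<or> {y, z} \<in> m \<Longrightarrow> (y, z) \<in> pair_graph e m"
  by (simp add: pair_graph_def)

lemma closed_under_pair_graphD:
  "closed_under (pair_graph e m) C \<Longrightarrow> y \<in> C \<Longrightarrow> {y, z} \<in> e \<or> {y, z} \<in> m \<Longrightarrow> z \<in> C"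
  using pair_graphI unfolding closed_under_def by metis

section \<open>The effect of a transposition on the components\<close>

locale transposed_pairing =
  fixes S :: "nat set" and e m :: "nat set set" and i x :: nat
  assumes e: "pairing_on S e" and m: "pairing_on S m"
    and i: "i \<in> S" and x: "x \<in> S" and ix: "i \<noteq> x"
begin

definition m' where "m' = perm_act (Transposition.transpose i x) m"

lemma m': "pairing_on S m'"
  unfolding m'_def by (rule pairing_on_perm_act[OF m i x])

lemma untouched_edge: "y \<notin> {i, x} \<Longrightarrow> z \<notin> {i, x} \<Longrightarrow> {y, z} \<in> m' \<longleftrightarrow> {y, z} \<in> m"
  by (simp add: m'_def mem_perm_act_transpose Transposition.transpose_def)

lemma moved_edge: "y \<notin> {i, x} \<Longrightarrow> {i, y} \<in> m' \<longleftrightarrow> {x, y} \<in> m"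
    "y \<notin> {i, x} \<Longrightarrow> {x, y} \<in> m' \<longleftrightarrow> {i, y} \<in> m"
  by (simp_all add: m'_def mem_perm_act_transpose Transposition.transpose_def)

lemma untouched_component:
  assumes D: "D \<in> pair_components S e m" "i \<notin> D" "x \<notin> D"
  shows "closed_under (pair_graph e m') D" "linked_by (pair_graph e m') D"
proof -
  note c = pair_components_partition(2)[OF e m D(1)] and l = pair_components_partition(3)[OF e m D(1)]
  have ne: "y \<notin> {i, x}" if "y \<in> D" for y using that D by auto
  show "closed_under (pair_graph e m') D"
    unfolding closed_under_def
  proof (intro ballI allI impI)
    fix y z assume y: "y \<in> D" and "(y, z) \<in> pair_graph e m'"
    then consider "{y, z} \<in> e" | "{y, z} \<in> m'" by (auto simp: pair_graph_def)
    then show "z \<in> D"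
    proof cases
      case 1
      then show ?thesis using closed_under_pair_graphD[OF c y] by blast
    next
      case 2
      let ?\<tau> = "Transposition.transpose i x"
      have "{y, ?\<tau> z} \<in> m" using 2 ne[OF y] by (simp add: m'_def mem_perm_act_transpose Transposition.transpose_def)
      then have "?\<tau> z \<in> D" using closed_under_pair_graphD[OF c y] by blast
      with ne have "?\<tau> z \<notin> {i, x}" by blast
      then have "?\<tau> z = z" by (auto simp: Transposition.transpose_def split: if_splits)
      with \<open>?\<tau> z \<in> D\<close> show ?thesis by simp
    qed
  qed
  show "linked_by (pair_graph e m') D"
    unfolding linked_by_def
  proof (intro ballI)
    fix y z assume y: "y \<in> D" and "z \<in> D"
    then have "(y, z) \<in> (pair_graph e m)\<^sup>*" using l by (simp add: linked_by_def)
    then show "(y, z) \<in> (pair_graph e m')\<^sup>*"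
    proof (induction rule: rtrancl_induct)
      case (step z w)
      then have "z \<in> D" "w \<in> D"
        using closed_under_rtrancl[OF c y] rtrancl_into_rtrancl[of y z] by blast+
      with ne step(2) untouched_edge[of z w] have "(z, w) \<in> pair_graph e m'"
        by (simp add: pair_graph_def)
      with step(3) show ?case by (rule rtrancl_into_rtrancl)
    qed simp
  qed
qed

lemma closed_under_transposed:
  assumes "closed_under (pair_graph e m) C" "i \<in> C" "x \<in> C"
  shows "closed_under (pair_graph e m') C"
  unfolding closed_under_def
proof (intro ballI allI impI)
  let ?\<tau> = "Transposition.transpose i x"
  have \<tau>: "?\<tau> y \<in> C \<longleftrightarrow> y \<in> C" for y using assms(2,3) by (auto simp: Transposition.transpose_def)
  fix y z assume y: "y \<in> C" and "(y, z) \<in> pair_graph e m'"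
  then consider "{y, z} \<in> e" | "{?\<tau> y, ?\<tau> z} \<in> m"
    by (auto simp: pair_graph_def m'_def mem_perm_act_transpose)
  then show "z \<in> C"
    using closed_under_pair_graphD[OF assms(1)] y \<tau> by cases blast+
qed

text \<open>Only \<open>m\<close>-edges, which leave from even positions, are changed, and only
  those at \<open>i\<close> or \<open>x\<close>; the \<open>e\<close>-edges may touch these points
  freely.\<close>

lemma segment_linked:
  assumes v: "alternating_cycle e m v a"
    and "\<And>t. even t \<Longrightarrow> l \<le> t \<Longrightarrow> t < u \<Longrightarrow> v t \<notin> {i, x} \<and> v (Suc t) \<notin> {i, x}"
  shows "linked_by (pair_graph e m') (v ` {l..u})"
proof (rule linked_by_segment[OF sym_pair_graph])
  fix t assume t: "l \<le> t" "t < u"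
  show "(v t, v (Suc t)) \<in> pair_graph e m'"
  proof (cases "even t")
    case True
    with assms(2) t untouched_edge cycle_edge(1)[OF v e m] show ?thesis by (intro pair_graphI) blast
  next
    case False
    with cycle_edge(2)[OF v e m] show ?thesis by (intro pair_graphI) blast
  qed
qed

text \<open>Each cycle loses one edge, at \<open>x\<close> and at \<open>i\<close>, and stays linked
  as an open walk. The new edge from \<open>v 1\<close> to \<open>i\<close> joins the two
  walks.\<close>

lemma components_merge:
  assumes v: "alternating_cycle e m v a" "v 0 = x" and w: "alternating_cycle e m w b" "w 0 = i"
    and "i \<notin> v ` {1..2*a}"
  shows "pair_components S e m' = insert (v ` {1..2*a} \<union> w ` {1..2*b})
      (pair_components S e m - {v ` {1..2*a}, w ` {1..2*b}})"
proof -
  define C where "C = v ` {1..2*a}"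
  define C' where "C' = w ` {1..2*b}"
  note P = pair_components_partition[OF e m]
  have C: "C \<in> pair_components S e m" unfolding C_def using cycle_component[OF v(1) e m] v x by simp
  have C': "C' \<in> pair_components S e m" unfolding C'_def using cycle_component[OF w(1) e m] w i by simp
  have xC: "x \<in> C" unfolding C_def using cycle_period[OF v(1) e m] cycle_pos[OF v(1) e m] v(2)
    by (auto intro!: image_eqI[of _ _ "2*a"])
  have iC': "i \<in> C'" unfolding C'_def using cycle_period[OF w(1) e m] cycle_pos[OF w(1) e m] w(2)
    by (auto intro!: image_eqI[of _ _ "2*b"])
  have iC: "i \<notin> C" using assms(5) by (simp add: C_def)
  with iC' have ne: "C \<noteq> C'" by auto
  then have disj: "C \<inter> C' = {}" using in_partition_eqI[OF P(1) C C'] by blast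
  with xC have xC': "x \<notin> C'" by blast
  have vx: "v t \<noteq> x" if "t \<in> {1..<2*a}" for t
    using cycle_eq_iff[OF v(1) e m, of t "2*a"] cycle_period[OF v(1) e m] v(2) that by auto
  have wi: "w t \<noteq> i" if "t \<in> {1..<2*b}" for t
    using cycle_eq_iff[OF w(1) e m, of t "2*b"] cycle_period[OF w(1) e m] w(2) that by auto
  have l: "linked_by (pair_graph e m') C" unfolding C_def
  proof (rule segment_linked[OF v(1)])
    fix t assume "even t" "1 \<le> t" "t < 2 * a"
    then have "t \<in> {1..<2*a}" "Suc t \<in> {1..<2*a}" by (auto; presburger)+
    then show "v t \<notin> {i, x} \<and> v (Suc t) \<notin> {i, x}" using vx iC by (force simp: C_def)
  qed
  have l': "linked_by (pair_graph e m') C'" unfolding C'_def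
  proof (rule segment_linked[OF w(1)])
    fix t assume "even t" "1 \<le> t" "t < 2 * b"
    then have "t \<in> {1..<2*b}" "Suc t \<in> {1..<2*b}" by (auto; presburger)+
    then show "w t \<notin> {i, x} \<and> w (Suc t) \<notin> {i, x}" using wi xC' by (force simp: C'_def)
  qed
  have v1: "v 1 \<in> C" using cycle_pos[OF v(1) e m] by (auto simp: C_def)
  have xv1: "{x, v 1} \<in> m" using cycle_edge(1)[OF v(1) e m, of 0] v(2) by simp
  moreover have "v 1 \<notin> {i, x}" using v1 iC pairing_on_neq[OF m xv1] by auto
  ultimately have "{v 1, i} \<in> m'" using moved_edge(1)[of "v 1"] xv1 by (metis insert_commute)
  then have "linked_by (pair_graph e m') (C \<union> C')"
    by (intro linked_by_Un[OF sym_pair_graph l l' v1 iC'] pair_graphI) simp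
  moreover have "closed_under (pair_graph e m') (C \<union> C')"
    using closed_under_Un[OF P(2)[OF C] P(2)[OF C']] xC iC' by (intro closed_under_transposed) auto
  moreover have "partition_on S (insert (C \<union> C') (pair_components S e m - {C, C'}))"
  proof (rule partition_onI)
    show "\<Union> (insert (C \<union> C') (pair_components S e m - {C, C'})) = S"
      using partition_onD1[OF P(1)] C C' by blast
    show "{} \<notin> insert (C \<union> C') (pair_components S e m - {C, C'})"
      using partition_onD3[OF P(1)] xC by auto
    fix p q assume "p \<in> insert (C \<union> C') (pair_components S e m - {C, C'})"
      "q \<in> insert (C \<union> C') (pair_components S e m - {C, C'})" "p \<noteq> q"
    then show "disjnt p q"
      using in_partition_eqI[OF P(1)] C C' unfolding disjnt_def by blast
  qed
  moreover have "i \<notin> D \<and> x \<notin> D" if "D \<in> pair_components S e m - {C, C'}" for D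
    using that in_partition_eqI[OF P(1) _ C, of D] in_partition_eqI[OF P(1) _ C', of D] xC iC' by blast
  ultimately have "pair_components S e m' = insert (C \<union> C') (pair_components S e m - {C, C'})"
    unfolding pair_components_def[of S e m'] using untouched_component by (intro quotient_eqI) auto
  then show ?thesis by (simp add: C_def C'_def)
qed

text \<open>Without its \<open>m\<close>-edges at \<open>x\<close> and \<open>i\<close> the cycle
  falls into the walks from \<open>v 1\<close> to \<open>v (2*s)\<close> and from
  \<open>v (2*s+1) = i\<close> to \<open>v (2*a) = x\<close>. The new edge joins their first points,
  so the cycle is reassembled with one walk reversed. For \<open>s = 0\<close> the first walk is
  empty: \<open>i\<close> is the \<open>m\<close>-mate of \<open>x\<close> and the arrow is a
  loop.\<close>

lemma components_reverse:
  assumes v: "alternating_cycle e m v a" "v 0 = x" and s: "s < a" "i = v (2 * s + 1)"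
  shows "pair_components S e m' = pair_components S e m"
proof -
  define C where "C = v ` {1..2*a}"
  note P = pair_components_partition[OF e m]
  note eq = cycle_eq_iff[OF v(1) e m]
  have C: "C \<in> pair_components S e m" unfolding C_def using cycle_component[OF v(1) e m] v x by simp
  have v2a: "v (2 * a) = x" using cycle_period[OF v(1) e m] v(2) by simp
  have xC: "x \<in> C" unfolding C_def using cycle_pos[OF v(1) e m] v2a
    by (auto intro!: image_eqI[of _ _ "2*a"])
  have iC: "i \<in> C" unfolding C_def using s by (auto intro!: image_eqI[of _ _ "2 * s+1"])
  have vx: "v t \<noteq> x" if "t \<in> {1..<2*a}" for t
    using eq[of t "2*a"] v2a that by auto
  have vi: "v t \<noteq> i" if "t \<in> {1..2*a} - {2 * s+1}" for t
    using eq[of t "2 * s+1"] s that by auto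
  have A: "linked_by (pair_graph e m') (v ` {1..2 * s})"
  proof (rule segment_linked[OF v(1)])
    fix t assume "even t" "1 \<le> t" "t < 2 * s"
    then have "t \<in> {1..<2*a}" "Suc t \<in> {1..<2*a}" "t \<in> {1..2*a} - {2 * s+1}" "Suc t \<in> {1..2*a} - {2 * s+1}"
      using s(1) by auto
    then show "v t \<notin> {i, x} \<and> v (Suc t) \<notin> {i, x}" using vx vi by blast
  qed
  have B: "linked_by (pair_graph e m') (v ` {2 * s+1..2*a})"
  proof (rule segment_linked[OF v(1)])
    fix t assume t: "even t" "2 * s+1 \<le> t" "t < 2 * a"
    then have "Suc t \<noteq> 2 * a" "t \<noteq> 2 * s+1" by presburger+
    with t have "t \<in> {1..<2*a}" "Suc t \<in> {1..<2*a}" "t \<in> {1..2*a} - {2 * s+1}" "Suc t \<in> {1..2*a} - {2 * s+1}"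
      by auto
    then show "v t \<notin> {i, x} \<and> v (Suc t) \<notin> {i, x}" using vx vi by blast
  qed
  have "linked_by (pair_graph e m') C"
  proof (cases "s = 0")
    case True
    with B show ?thesis by (simp add: C_def)
  next
    case False
    have "{x, v 1} \<in> m" using cycle_edge(1)[OF v(1) e m, of 0] v(2) by simp
    moreover have "v 1 \<notin> {i, x}" using vx[of 1] vi[of 1] s(1) False by auto
    ultimately have "{v 1, i} \<in> m'" using moved_edge(1)[of "v 1"] by (metis insert_commute)
    then have "linked_by (pair_graph e m') (v ` {1..2 * s} \<union> v ` {2 * s+1..2*a})"
      using False s by (intro linked_by_Un[OF sym_pair_graph A B] pair_graphI) auto
    moreover have "{1..2 * s} \<union> {2 * s+1..2*a} = {1..2*a}" using s(1) by auto
    ultimately show ?thesis by (simp only: C_def flip: image_Un)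
  qed
  moreover have "closed_under (pair_graph e m') C"
    by (rule closed_under_transposed[OF P(2)[OF C] iC xC])
  moreover have "i \<notin> D \<and> x \<notin> D" if "D \<in> pair_components S e m" "D \<noteq> C" for D
    using that in_partition_eqI[OF P(1) _ C, of D] xC iC by blast
  ultimately show ?thesis
    unfolding pair_components_def[of S e m'] using untouched_component
    by (intro quotient_eqI[OF P(1)]) metis
qed

text \<open>The cuts are as for a reversal, but now \<open>i = v (2*s)\<close> ends the first walk:
  the new edge joins \<open>i\<close> to \<open>v 1\<close> and makes a cycle of its own. The second
  walk is closed because it is the complement of the first in the old component.\<close>

lemma components_split:
  assumes v: "alternating_cycle e m v a" "v 0 = x" and s: "0 < s" "s < a" "i = v (2 * s)"
  shows "pair_components S e m' = insert (v ` {1..2 * s}) (insert (v ` {2 * s+1..2*a})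
      (pair_components S e m - {v ` {1..2*a}}))"
proof -
  define C where "C = v ` {1..2*a}"
  define A where "A = v ` {1..2 * s}"
  define B where "B = v ` {2 * s+1..2*a}"
  note P = pair_components_partition[OF e m]
  note eq = cycle_eq_iff[OF v(1) e m]
  have C: "C \<in> pair_components S e m" unfolding C_def using cycle_component[OF v(1) e m] v x by simp
  have v2a: "v (2 * a) = x" using cycle_period[OF v(1) e m] v(2) by simp
  have xC: "x \<in> C" unfolding C_def using cycle_pos[OF v(1) e m] v2a
    by (auto intro!: image_eqI[of _ _ "2*a"])
  have iC: "i \<in> C" unfolding C_def using s by (auto intro!: image_eqI[of _ _ "2 * s"])
  have vx: "v t \<noteq> x" if "t \<in> {1..<2*a}" for t
    using eq[of t "2*a"] v2a that by auto
  have vi: "v t \<noteq> i" if "t \<in> {1..2*a} - {2 * s}" for t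
    using eq[of t "2 * s"] s that by auto
  have lA: "linked_by (pair_graph e m') A" unfolding A_def
  proof (rule segment_linked[OF v(1)])
    fix t assume t: "even t" "1 \<le> t" "t < 2 * s"
    then have "Suc t \<noteq> 2 * s" by presburger
    with t have "t \<in> {1..<2*a}" "Suc t \<in> {1..<2*a}" "t \<in> {1..2*a} - {2 * s}" "Suc t \<in> {1..2*a} - {2 * s}"
      using s by auto
    then show "v t \<notin> {i, x} \<and> v (Suc t) \<notin> {i, x}" using vx vi by blast
  qed
  have lB: "linked_by (pair_graph e m') B" unfolding B_def
  proof (rule segment_linked[OF v(1)])
    fix t assume t: "even t" "2 * s+1 \<le> t" "t < 2 * a"
    then have "Suc t \<noteq> 2 * a" by presburger
    with t have "t \<in> {1..<2*a}" "Suc t \<in> {1..<2*a}" "t \<in> {1..2*a} - {2 * s}" "Suc t \<in> {1..2*a} - {2 * s}"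
      by auto
    then show "v t \<notin> {i, x} \<and> v (Suc t) \<notin> {i, x}" using vx vi by blast
  qed
  have "{x, v 1} \<in> m" using cycle_edge(1)[OF v(1) e m, of 0] v(2) by simp
  moreover have v1: "v 1 \<notin> {i, x}" using vx[of 1] vi[of 1] s by auto
  ultimately have iv1: "{i, v 1} \<in> m'" using moved_edge(1)[of "v 1"] by simp
  have cA: "closed_under (pair_graph e m') A"
  proof (rule closed_under_pair_graph[OF e m'])
    fix y assume "y \<in> A"
    then obtain t where t: "t \<in> {1..2 * s}" "y = v t" by (auto simp: A_def)
    show "\<exists>z\<in>A. {y, z} \<in> e"
    proof (cases "odd t")
      case True
      then have "t \<noteq> 2 * s" by auto
      then have "v (Suc t) \<in> A" using t by (auto simp: A_def)
      with cycle_edge(2)[OF v(1) e m True] t show ?thesis by blast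
    next
      case False
      then have "t \<noteq> 1" by auto
      with t False have "t - 1 \<in> {1..2 * s}" "odd (t - 1)" "Suc (t - 1) = t" by auto
      moreover from this have "v (t - 1) \<in> A" unfolding A_def by blast
      ultimately show ?thesis using cycle_edge(2)[OF v(1) e m, of "t - 1"] t by (metis insert_commute)
    qed
    show "\<exists>z\<in>A. {y, z} \<in> m'"
    proof -
      \<comment> \<open>Under \<open>m'\<close> the ends \<open>v 1\<close> and
        \<open>v (2*s)\<close> are mates; every other point of \<open>A\<close> keeps its
        \<open>m\<close>-mate, one position before it or after it according to parity.\<close>
      consider "t = 1" | "t = 2 * s" | "odd t" "t \<noteq> 1" | "even t" "t \<noteq> 2 * s" by blast
      then show ?thesis
      proof cases
        case 1
        moreover have "i \<in> A" using s by (auto simp: A_def)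
        ultimately show ?thesis using iv1 t by (metis insert_commute)
      next
        case 2
        moreover have "v 1 \<in> A" using s by (auto simp: A_def)
        ultimately show ?thesis using iv1 t s by metis
      next
        case 3
        with t have "t - 1 \<in> {1..2 * s}" by auto
        then have "v (t - 1) \<in> A" unfolding A_def by blast
        moreover from 3 t have "even (t - 1)" "Suc (t - 1) = t" "t \<noteq> 2 * s" "t - 1 \<noteq> 2 * s"
          "t - 1 \<in> {1..<2*a}" "t \<in> {1..<2*a}"
          using s \<open>t - 1 \<in> {1..2 * s}\<close> by auto
        ultimately have t': "v (t - 1) \<in> A" "even (t - 1)" "Suc (t - 1) = t" "t \<noteq> 2 * s" "t - 1 \<noteq> 2 * s"
          "t - 1 \<in> {1..<2*a}" "t \<in> {1..<2*a}" by blast+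
        then have "v (t - 1) \<notin> {i, x}" "v t \<notin> {i, x}" using vx vi by auto
        moreover have "{v (t - 1), v t} \<in> m"
          using cycle_edge(1)[OF v(1) e m t'(2)] t'(3) by simp
        ultimately have "{v t, v (t - 1)} \<in> m'"
          using untouched_edge[of "v (t - 1)" "v t"] by (simp add: insert_commute)
        with t' t show ?thesis by blast
      next
        case 4
        then have "Suc t \<noteq> 2 * s" by presburger
        with 4 t have t': "v (Suc t) \<in> A" "Suc t \<noteq> 2 * s" "Suc t \<in> {1..<2*a}" "t \<in> {1..<2*a}"
          using s by (auto simp: A_def)
        with 4 have "v t \<notin> {i, x}" "v (Suc t) \<notin> {i, x}" using vx vi by auto
        with cycle_edge(1)[OF v(1) e m 4(1)] have "{v t, v (Suc t)} \<in> m'"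
          using untouched_edge by blast
        with t' t show ?thesis by blast
      qed
    qed
  qed
  have AB: "A \<inter> B = {}"
  proof -
    have "v t \<noteq> v t'" if "t \<in> {1..2 * s}" "t' \<in> {2 * s+1..2*a}" for t t'
      using eq[of t t'] that s by auto
    then show ?thesis by (auto simp: A_def B_def)
  qed
  have "{1..2 * s} \<union> {2 * s+1..2*a} = {1..2*a}" using s by auto
  then have Un: "A \<union> B = C" by (simp only: A_def B_def C_def flip: image_Un)
  have ne: "A \<noteq> {}" "B \<noteq> {}" using s by (auto simp: A_def B_def)
  have c: "closed_under (pair_graph e m') C"
    by (rule closed_under_transposed[OF P(2)[OF C] iC xC])
  have cB: "closed_under (pair_graph e m') B"
  proof -
    have "B = C - A" using Un AB by blast
    then show ?thesis using closed_under_Diff[OF sym_pair_graph c cA] by simp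
  qed
  have part: "partition_on S (insert A (insert B (pair_components S e m - {C})))"
  proof (rule partition_onI)
    show "\<Union> (insert A (insert B (pair_components S e m - {C}))) = S"
      using partition_onD1[OF P(1)] C Un by blast
    show "{} \<notin> insert A (insert B (pair_components S e m - {C}))"
      using partition_onD3[OF P(1)] ne by auto
    have *: "disjnt D A" "disjnt D B" if "D \<in> pair_components S e m - {C}" for D
      using in_partition_eqI[OF P(1) C, of D] that Un unfolding disjnt_def by blast+
    fix p q assume "p \<in> insert A (insert B (pair_components S e m - {C}))"
      "q \<in> insert A (insert B (pair_components S e m - {C}))" "p \<noteq> q"
    then show "disjnt p q"
      using * AB disjnt_sym in_partition_eqI[OF P(1), of p q] unfolding disjnt_def by blast
  qed
  have "i \<notin> D \<and> x \<notin> D" if "D \<in> pair_components S e m" "D \<noteq> C" for D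
    using that in_partition_eqI[OF P(1) _ C, of D] xC iC by blast
  then have "pair_components S e m' = insert A (insert B (pair_components S e m - {C}))"
    unfolding pair_components_def[of S e m']
    using untouched_component lA lB cA cB by (intro quotient_eqI[OF part]) blast
  then show ?thesis by (simp add: A_def B_def C_def)
qed

end

section \<open>Pair partitions and the removal of the last block\<close>

lemma pair_partitions_iff: "m \<in> pair_partitions k \<longleftrightarrow> pairing_on {1..2*k} m"
  by (simp add: pair_partitions_def pairing_on_def)

lemma partition_on_insert_block:
  assumes "partition_on S P" "b \<noteq> {}" "b \<inter> S = {}"
  shows "partition_on (b \<union> S) (insert b P)"
proof (rule partition_onI)
  have S: "S = \<Union> P" using assms(1) by (rule partition_onD1)
  then show "\<Union> (insert b P) = b \<union> S" by simp
  show "{} \<notin> insert b P" using assms partition_onD3 by blast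
  fix p q assume "p \<in> insert b P" "q \<in> insert b P" "p \<noteq> q"
  then show "disjnt p q"
    using in_partition_eqI[OF assms(1), of p q] assms(3) S unfolding disjnt_def by blast
qed

lemma partition_on_remove_block:
  assumes "partition_on S P" "b \<in> P"
  shows "partition_on (S - b) (P - {b})"
proof (rule partition_onI)
  have S: "S = \<Union> P" using assms(1) by (rule partition_onD1)
  have disj: "p \<inter> b = {}" if "p \<in> P - {b}" for p
    using in_partition_eqI[OF assms(1) _ assms(2), of p] that by blast
  show "\<Union> (P - {b}) = S - b" unfolding S using disj by blast
  show "{} \<notin> P - {b}" using assms partition_onD3 by blast
  fix p q assume "p \<in> P - {b}" "q \<in> P - {b}" "p \<noteq> q"
  then show "disjnt p q"
    using in_partition_eqI[OF assms(1), of p q] unfolding disjnt_def by blast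
qed

lemma pairing_on_insert:
  assumes "pairing_on {1..2*n} m"
  shows "pairing_on {1..2 * Suc n} (insert {2*n+1, 2*n+2} m)"
proof -
  have S: "{1..2 * Suc n} = {2*n+1, 2*n+2} \<union> {1..2*n}" by auto
  have "partition_on {1..2 * Suc n} (insert {2*n+1, 2*n+2} m)"
    unfolding S using assms
    by (intro partition_on_insert_block) (auto simp: pairing_on_def)
  then show ?thesis using assms by (auto simp: pairing_on_def)
qed

lemma pairing_on_remove:
  assumes "pairing_on {1..2 * Suc n} m" "{2*n+1, 2*n+2} \<in> m"
  shows "pairing_on {1..2*n} (m - {{2*n+1, 2*n+2}})"
proof -
  have "partition_on {1..2 * Suc n} m" using assms by (simp add: pairing_on_def)
  moreover have "{1..2*n} = {1..2 * Suc n} - {2*n+1, 2*n+2}" by auto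
  ultimately have "partition_on {1..2*n} (m - {{2*n+1, 2*n+2}})"
    using partition_on_remove_block[OF _ assms(2)] by simp
  then show ?thesis using assms by (auto simp: pairing_on_def)
qed

lemma trivial_pairing_Suc: "trivial_pairing (Suc n) = insert {2*n+1, 2*n+2} (trivial_pairing n)"
proof -
  have "{1..Suc n} = insert (Suc n) {1..n}" by auto
  then show ?thesis by (simp add: trivial_pairing_def)
qed

lemma pairing_on_trivial_pairing: "pairing_on {1..2*k} (trivial_pairing k)"
proof (induction k)
  case 0
  then show ?case by (simp add: pairing_on_def partition_on_def trivial_pairing_def)
next
  case (Suc n)
  then show ?case using pairing_on_insert trivial_pairing_Suc by metis
qed

lemma pairing_components_eq:
  "pairing_components k m = pair_components {1..2*k} (trivial_pairing k) m"
  by (simp add: pairing_components_def pair_components_def pair_graph_def)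

lemma pairing_norm_eq: "pairing_norm k m = k - card (pairing_components k m)"
  by (simp add: pairing_norm_def coset_type_def)

text \<open>The number of shortest paths to the empty pairing, as
  \<open>card_geodesic_weingarten_paths\<close> shows: a component of size \<open>2 a\<close>
  contributes the Catalan number with index \<open>a - 1\<close>.\<close>

definition catalan_weight :: "nat \<Rightarrow> nat set set \<Rightarrow> real" where
  "catalan_weight k m = (\<Prod>D\<in>pairing_components k m. shifted_catalan (card D div 2))"

lemma pair_partitions_transpose:
  assumes "m \<in> pair_partitions k" "i \<in> {1..<2*k-1}"
  shows "perm_act (Transposition.transpose i (2*k-1)) m \<in> pair_partitions k"
  using assms pairing_on_perm_act[of "{1..2*k}" m i "2*k-1"] by (auto simp: pair_partitions_iff)

lemma pair_partitions_remove:
  assumes "m \<in> pair_partitions (Suc n)" "{2*n+1, 2*n+2} \<in> m"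
  shows "m - {{2*n+1, 2*n+2}} \<in> pair_partitions n"
  using assms pairing_on_remove by (simp add: pair_partitions_iff)

lemma card_pairing_components_le: "m \<in> pair_partitions k \<Longrightarrow> card (pairing_components k m) \<le> k"
  using card_pair_components_le[OF _ pairing_on_trivial_pairing, of k m]
  by (simp add: pair_partitions_iff pairing_components_eq)

lemma finite_pairing_components: "m \<in> pair_partitions k \<Longrightarrow> finite (pairing_components k m)"
  using finite_pair_components[OF _ pairing_on_trivial_pairing, of k m]
  by (simp add: pair_partitions_iff pairing_components_eq)

text \<open>The last block belongs to both pairings, so it is a component by itself and the rest of
  the graph does not see it.\<close>

lemma pairing_components_remove:
  assumes m: "m \<in> pair_partitions (Suc n)" and b: "{2*n+1, 2*n+2} \<in> m"
  shows "pairing_components (Suc n) m =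
    insert {2*n+1, 2*n+2} (pairing_components n (m - {{2*n+1, 2*n+2}}))"
proof -
  let ?b = "{2*n+1, 2*n+2}"
  let ?m = "m - {?b}" and ?e = "trivial_pairing n"
  let ?r = "pair_graph (trivial_pairing (Suc n)) m"
  have m': "pairing_on {1..2*n} ?m" using pair_partitions_remove[OF assms] by (simp add: pair_partitions_iff)
  note P = pair_components_partition[OF pairing_on_trivial_pairing m']
  have r: "?r = pair_graph ?e ?m \<union> {(2*n+1, 2*n+2), (2*n+2, 2*n+1)}"
    using b by (auto simp: trivial_pairing_Suc pair_graph_def doubleton_eq_iff)
  have "pair_components {1..2 * Suc n} (trivial_pairing (Suc n)) m =
      insert ?b (pair_components {1..2*n} ?e ?m)"
    unfolding pair_components_def[of "{1..2 * Suc n}"]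
  proof (rule quotient_eqI)
    have "{1..2 * Suc n} = ?b \<union> {1..2*n}" by auto
    moreover have "partition_on (?b \<union> {1..2*n}) (insert ?b (pair_components {1..2*n} ?e ?m))"
      using P(1) by (intro partition_on_insert_block) auto
    ultimately show "partition_on {1..2 * Suc n} (insert ?b (pair_components {1..2*n} ?e ?m))" by simp
    fix D assume "D \<in> insert ?b (pair_components {1..2*n} ?e ?m)"
    then consider "D = ?b" | "D \<in> pair_components {1..2*n} ?e ?m" by blast
    then show "closed_under ?r D \<and> linked_by ?r D"
    proof cases
      case 1
      have "z \<in> {1..2*n}" "y \<in> {1..2*n}" if "(y, z) \<in> pair_graph ?e ?m" for y z
        using that pairing_on_subset[OF pairing_on_trivial_pairing, of "{y,z}" n]
          pairing_on_subset[OF m', of "{y, z}"]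
        unfolding pair_graph_def by blast+
      then have "closed_under ?r D" unfolding closed_under_def r 1 by force
      moreover have "linked_by ?r D" unfolding linked_by_def r 1 by auto
      ultimately show ?thesis by blast
    next
      case 2
      have "D \<subseteq> {1..2*n}" using 2 partition_onD1[OF P(1)] by blast
      then have "2*n+1 \<notin> D" "2*n+2 \<notin> D" by auto
      then have "closed_under ?r D" using P(2)[OF 2] unfolding closed_under_def r by blast
      moreover have "linked_by ?r D"
        using P(3)[OF 2] rtrancl_mono[of "pair_graph ?e ?m" ?r] unfolding linked_by_def r by blast
      ultimately show ?thesis by blast
    qed
  qed
  then show ?thesis by (simp add: pairing_components_eq)
qed

text \<open>The level and the number of components drop by one together, and the factor lost is
  \<open>shifted_catalan (Suc 0) = 1\<close>.\<close>

lemma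
  assumes m: "m \<in> pair_partitions (Suc n)" and b: "{2*n+1, 2*n+2} \<in> m"
  shows pairing_norm_remove: "pairing_norm n (m - {{2*n+1, 2*n+2}}) = pairing_norm (Suc n) m"
    and catalan_weight_remove: "catalan_weight n (m - {{2*n+1, 2*n+2}}) = catalan_weight (Suc n) m"
proof -
  let ?m = "m - {{2*n+1, 2*n+2}}"
  have m': "?m \<in> pair_partitions n" using pair_partitions_remove[OF assms] .
  have "\<Union> (pairing_components n ?m) = {1..2*n}"
    using partition_onD1[OF pair_components_partition(1)[OF pairing_on_trivial_pairing, of n ?m]] m'
    by (simp add: pair_partitions_iff pairing_components_eq)
  moreover have "2*n+1 \<notin> {1..2*n}" by simp
  ultimately have "{2*n+1, 2*n+2} \<notin> pairing_components n ?m" by blast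
  then show "pairing_norm n ?m = pairing_norm (Suc n) m"
    "catalan_weight n ?m = catalan_weight (Suc n) m"
    using finite_pairing_components[OF m']
    unfolding pairing_norm_eq catalan_weight_def pairing_components_remove[OF assms] by simp_all
qed

section \<open>Norm and weight along solid arrows\<close>

lemma partition_split_block:
  fixes f :: "'a set \<Rightarrow> 'b::comm_monoid_mult"
  assumes "finite P" "partition_on S P" "C \<in> P" "A \<union> B = C" "A \<inter> B = {}" "A \<noteq> {}" "B \<noteq> {}"
  shows "card (insert A (insert B (P - {C}))) = Suc (card P)"
    and "prod f (insert A (insert B (P - {C}))) * f C = prod f P * (f A * f B)"
proof -
  have "A \<notin> P - {C}" "B \<notin> P - {C}"
    using in_partition_eqI[OF assms(2,3), of A] in_partition_eqI[OF assms(2,3), of B] assms by blast+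
  moreover have "A \<noteq> B" using assms by blast
  moreover have "card P = Suc (card (P - {C}))" "prod f P = f C * prod f (P - {C})"
    using card.remove[OF assms(1,3)] prod.remove[OF assms(1,3)] by blast+
  ultimately show "card (insert A (insert B (P - {C}))) = Suc (card P)"
    "prod f (insert A (insert B (P - {C}))) * f C = prod f P * (f A * f B)"
    using assms(1) by (simp_all add: mult_ac)
qed

lemma partition_merge_blocks:
  fixes f :: "'a set \<Rightarrow> 'b::comm_monoid_mult"
  assumes "finite P" "partition_on S P" "C \<in> P" "C' \<in> P" "C \<noteq> C'"
  shows "Suc (card (insert (C \<union> C') (P - {C, C'}))) = card P"
    and "prod f (insert (C \<union> C') (P - {C, C'})) * (f C * f C') = prod f P * f (C \<union> C')"
proof -
  have "C \<noteq> {}" using assms partition_onD3 by blast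
  then have 1: "C \<union> C' \<notin> P - {C, C'}"
    using in_partition_eqI[OF assms(2,3), of "C \<union> C'"] by blast
  have P: "P = insert C (insert C' (P - {C, C'}))" using assms by blast
  have "card P = Suc (Suc (card (P - {C, C'})))"
    by (subst P) (use assms in simp)
  with 1 show "Suc (card (insert (C \<union> C') (P - {C, C'}))) = card P" using assms(1) by simp
  have "prod f P = f C * (f C' * prod f (P - {C, C'}))"
    by (subst P) (use assms in simp)
  with 1 show "prod f (insert (C \<union> C') (P - {C, C'})) * (f C * f C') = prod f P * f (C \<union> C')"
    using assms(1) by (simp add: mult_ac)
qed

lemma shifted_catalan_block_pos:
  assumes "m \<in> pair_partitions k" "D \<in> pairing_components k m"
  shows "0 < shifted_catalan (card D div 2)"
proof -
  have m: "pairing_on {1..2*k} m" using assms(1) by (simp add: pair_partitions_iff)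
  note P = pair_components_partition[OF pairing_on_trivial_pairing m]
  have D: "D \<in> pair_components {1..2*k} (trivial_pairing k) m"
    using assms(2) by (simp add: pairing_components_eq)
  then have "D \<noteq> {}" "D \<subseteq> {1..2*k}" using partition_onD1[OF P(1)] partition_onD3[OF P(1)] by blast+
  then obtain y where y: "y \<in> D" "y \<in> {1..2*k}" by blast
  have "mate m y \<in> D"
    using closed_under_pair_graphD[OF P(2)[OF D] y(1)] mate_edge[OF m y(2)] by blast
  moreover have "mate m y \<noteq> y" using mate_neq[OF m y(2)] .
  ultimately have "card {y, mate m y} = 2" "{y, mate m y} \<subseteq> D" using y by auto
  then have "2 \<le> card D" using card_mono[of D "{y, mate m y}"] finite_subset[OF \<open>D \<subseteq> _\<close>] by simp
  then show ?thesis by (intro shifted_catalan_pos) simp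
qed

lemma catalan_weight_pos: "m \<in> pair_partitions k \<Longrightarrow> 0 < catalan_weight k m"
  unfolding catalan_weight_def by (intro prod_pos) (rule shifted_catalan_block_pos)

lemma
  assumes m: "m \<in> pair_partitions k" and k: "1 \<le> k"
    and v: "alternating_cycle (trivial_pairing k) m v a" "v 0 = 2*k-1"
    and i: "i \<in> {1..<2*k-1}" "i \<notin> v ` {1..2*a}"
  shows pairing_norm_merge: "pairing_norm k (perm_act (Transposition.transpose i (2*k-1)) m) = Suc (pairing_norm k m)"
    and catalan_weight_merge: "catalan_weight k (perm_act (Transposition.transpose i (2*k-1)) m)
      \<le> 4 * real k ^ 4 * catalan_weight k m"
proof -
  have p: "pairing_on {1..2*k} m" using m by (simp add: pair_partitions_iff)
  note e = pairing_on_trivial_pairing[of k]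
  interpret T: transposed_pairing "{1..2*k}" "trivial_pairing k" m i "2*k-1"
    using p e i k by unfold_locales auto
  obtain w b where w: "alternating_cycle (trivial_pairing k) m w b" "w 0 = i"
    using alternating_cycle_ex[OF _ e p T.i] by auto
  let ?P = "pairing_components k m" and ?C = "v ` {1..2*a}" and ?C' = "w ` {1..2*b}"
  let ?m = "perm_act (Transposition.transpose i (2*k-1)) m"
  note P = pair_components_partition(1)[OF e p, folded pairing_components_eq]
  have C: "?C \<in> ?P" "?C' \<in> ?P"
    using cycle_component[OF v(1) e p] cycle_component[OF w(1) e p] v(2) w(2) T.i T.x
    by (simp_all add: pairing_components_eq)
  have "i \<in> ?C'" using cycle_period[OF w(1) e p] cycle_pos[OF w(1) e p] w(2)
    by (auto intro!: image_eqI[of _ _ "2*b"])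
  with i(2) have ne: "?C \<noteq> ?C'" by blast
  have eq: "pairing_components k ?m = insert (?C \<union> ?C') (?P - {?C, ?C'})"
    using T.components_merge[OF v w i(2)] unfolding pairing_components_eq T.m'_def .
  note merge = partition_merge_blocks[OF finite_pairing_components[OF m] P C ne, folded eq]
  \<comment> \<open>A merge leaves one component fewer. Since there were at most \<open>k\<close>,
    the subtraction in the norm does not truncate and the norm goes up by exactly one.\<close>
  have "card (pairing_components k ?m) < k" "card ?P \<le> k"
    using merge(1) card_pairing_components_le[OF m] by linarith+
  then show "pairing_norm k ?m = Suc (pairing_norm k m)"
    using merge(1) unfolding pairing_norm_eq by linarith
  have cards: "card ?C = 2 * a" "card ?C' = 2 * b"
    using card_image[OF cycle_inj[OF v(1) e p]] card_image[OF cycle_inj[OF w(1) e p]] by auto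
  have "?C \<subseteq> {1..2*k}" "?C' \<subseteq> {1..2*k}" using C partition_onD1[OF P] by blast+
  then have "card ?C \<le> 2 * k" "card ?C' \<le> 2 * k" using card_mono[of "{1..2*k}"] by force+
  with cards have ab: "a \<le> k" "b \<le> k" "1 \<le> a" "1 \<le> b"
    using cycle_pos[OF v(1) e p] cycle_pos[OF w(1) e p] by auto
  have "?C \<inter> ?C' = {}" using in_partition_eqI[OF P C] ne by blast
  then have "card (?C \<union> ?C') = card ?C + card ?C'" by (intro card_Un_disjoint) auto
  then have cardU: "card (?C \<union> ?C') = 2 * (a + b)" unfolding cards by simp
  have "catalan_weight k ?m * (shifted_catalan a * shifted_catalan b) =
      catalan_weight k m * shifted_catalan (a + b)"
    using merge(2)[of "\<lambda>D. shifted_catalan (card D div 2)"]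
    unfolding catalan_weight_def cards cardU by simp
  also have "\<dots> \<le> catalan_weight k m * (4 * real k ^ 4 * (shifted_catalan a * shifted_catalan b))"
    using catalan_weight_pos[OF m] ab by (intro mult_left_mono shifted_catalan_add_le) auto
  finally show "catalan_weight k ?m \<le> 4 * real k ^ 4 * catalan_weight k m"
    using shifted_catalan_pos[OF ab(3)] shifted_catalan_pos[OF ab(4)] by (simp add: mult_ac)
qed

text \<open>In the weight only the factor \<open>shifted_catalan a\<close> is replaced. After
  division by it, the sum over all \<open>s\<close> is the Catalan convolution.\<close>

lemma
  assumes m: "m \<in> pair_partitions k" and k: "1 \<le> k"
    and v: "alternating_cycle (trivial_pairing k) m v a" "v 0 = 2*k-1"
    and s: "0 < s" "s < a" "v (2 * s) \<in> {1..<2*k-1}"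
  shows pairing_norm_split: "Suc (pairing_norm k (perm_act (Transposition.transpose (v (2 * s)) (2*k-1)) m)) = pairing_norm k m"
    and catalan_weight_split: "catalan_weight k (perm_act (Transposition.transpose (v (2 * s)) (2*k-1)) m) * shifted_catalan a =
      catalan_weight k m * (shifted_catalan s * shifted_catalan (a - s))"
proof -
  have p: "pairing_on {1..2*k} m" using m by (simp add: pair_partitions_iff)
  note e = pairing_on_trivial_pairing[of k]
  interpret T: transposed_pairing "{1..2*k}" "trivial_pairing k" m "v (2 * s)" "2*k-1"
    using p e s(3) k by unfold_locales auto
  let ?P = "pairing_components k m" and ?C = "v ` {1..2*a}"
  let ?A = "v ` {1..2 * s}" and ?B = "v ` {2 * s+1..2*a}"
  let ?m = "perm_act (Transposition.transpose (v (2 * s)) (2*k-1)) m"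
  note P = pair_components_partition(1)[OF e p, folded pairing_components_eq]
  have m': "?m \<in> pair_partitions k" using T.m' unfolding pair_partitions_iff T.m'_def .
  have C: "?C \<in> ?P"
    using cycle_component[OF v(1) e p] v(2) T.x by (simp add: pairing_components_eq)
  have eq: "pairing_components k ?m = insert ?A (insert ?B (?P - {?C}))"
    using T.components_split[OF v s(1,2) refl] unfolding pairing_components_eq T.m'_def .
  have "{1..2 * s} \<union> {2 * s+1..2*a} = {1..2*a}" using s by auto
  then have Un: "?A \<union> ?B = ?C" by (simp only: flip: image_Un)
  note inj = cycle_inj[OF v(1) e p]
  have "?A \<inter> ?B = v ` ({1..2 * s} \<inter> {2 * s+1..2*a})"
    using s by (intro inj_on_image_Int[OF inj, symmetric]) auto
  then have Int: "?A \<inter> ?B = {}" by simp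
  have ne: "?A \<noteq> {}" "?B \<noteq> {}" using s by auto
  note split = partition_split_block[OF finite_pairing_components[OF m] P C Un Int ne, folded eq]
  show "Suc (pairing_norm k ?m) = pairing_norm k m"
    using split(1) card_pairing_components_le[OF m'] unfolding pairing_norm_eq by linarith
  have "card ?A = 2 * s" "card ?B = 2 * (a - s)" "card ?C = 2 * a"
    using card_image[OF inj_on_subset[OF inj, of "{1..2 * s}"]]
      card_image[OF inj_on_subset[OF inj, of "{2 * s+1..2*a}"]] card_image[OF inj] s by auto
  then show "catalan_weight k ?m * shifted_catalan a =
      catalan_weight k m * (shifted_catalan s * shifted_catalan (a - s))"
    using split(2)[of "\<lambda>D. shifted_catalan (card D div 2)"] by (simp add: catalan_weight_def)
qed

lemma
  assumes m: "m \<in> pair_partitions k" and k: "1 \<le> k"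
    and v: "alternating_cycle (trivial_pairing k) m v a" "v 0 = 2*k-1"
    and s: "s < a" "v (2 * s + 1) \<in> {1..<2*k-1}"
  shows pairing_norm_reverse: "pairing_norm k (perm_act (Transposition.transpose (v (2 * s + 1)) (2*k-1)) m) = pairing_norm k m"
    and catalan_weight_reverse: "catalan_weight k (perm_act (Transposition.transpose (v (2 * s + 1)) (2*k-1)) m) = catalan_weight k m"
proof -
  have p: "pairing_on {1..2*k} m" using m by (simp add: pair_partitions_iff)
  note e = pairing_on_trivial_pairing[of k]
  interpret T: transposed_pairing "{1..2*k}" "trivial_pairing k" m "v (2 * s + 1)" "2*k-1"
    using p e s(2) k by unfold_locales auto
  have "pairing_components k (perm_act (Transposition.transpose (v (2 * s + 1)) (2*k-1)) m) = pairing_components k m"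
    using T.components_reverse[OF v s(1) refl] unfolding pairing_components_eq T.m'_def .
  then show "pairing_norm k (perm_act (Transposition.transpose (v (2 * s + 1)) (2*k-1)) m) = pairing_norm k m"
    "catalan_weight k (perm_act (Transposition.transpose (v (2 * s + 1)) (2*k-1)) m) = catalan_weight k m"
    by (simp_all add: pairing_norm_eq catalan_weight_def)
qed

text \<open>The three kinds of solid arrows: along the component of \<open>2n+1\<close> they split it or preserve it,
  depending on the parity of the distance, and all other arrows merge two components.\<close>

lemma solid_steps:
  assumes m: "m \<in> pair_partitions (Suc n)"
  defines "step \<equiv> \<lambda>i. perm_act (Transposition.transpose i (2*n+1)) m"
  obtains Sp Re Me where
    "{1..2*n} = Sp \<union> (Re \<union> Me)" "Sp \<inter> (Re \<union> Me) = {}" "Re \<inter> Me = {}"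
    and "\<And>i. i \<in> Sp \<Longrightarrow> Suc (pairing_norm (Suc n) (step i)) = pairing_norm (Suc n) m"
    and "\<And>i. i \<in> Re \<Longrightarrow> pairing_norm (Suc n) (step i) = pairing_norm (Suc n) m"
    and "\<And>i. i \<in> Re \<Longrightarrow> catalan_weight (Suc n) (step i) = catalan_weight (Suc n) m"
    and "\<And>i. i \<in> Me \<Longrightarrow> pairing_norm (Suc n) (step i) = Suc (pairing_norm (Suc n) m)"
    and "\<And>i. i \<in> Me \<Longrightarrow> catalan_weight (Suc n) (step i) \<le> 4 * real (Suc n) ^ 4 * catalan_weight (Suc n) m"
    and "(\<Sum>i\<in>Sp. catalan_weight (Suc n) (step i)) +
      (if {2*n+1, 2*n+2} \<in> m then catalan_weight n (m - {{2*n+1, 2*n+2}}) else 0) = catalan_weight (Suc n) m"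
proof -
  let ?k = "Suc n"
  have p: "pairing_on {1..2*?k} m" using m by (simp add: pair_partitions_iff)
  note e = pairing_on_trivial_pairing[of ?k]
  have x: "2*n+1 \<in> {1..2*?k}" by simp
  obtain v a where v: "alternating_cycle (trivial_pairing ?k) m v a" "v 0 = 2*n+1"
    using alternating_cycle_ex[OF _ e p x] by auto
  have v0: "v 0 = 2*?k-1" and x': "2*n+1 = 2*?k-1" using v(2) by simp_all
  note inj = cycle_inj[OF v(1) e p] and eq = cycle_eq_iff[OF v(1) e p] and pos = cycle_pos[OF v(1) e p]
  have v2a: "v (2 * a) = 2*n+1" using cycle_period[OF v(1) e p] v(2) by simp
  \<comment> \<open>The \<open>e\<close>-mate of the starting point sits one step before the end of
    the cycle. The last two positions are thus \<open>2*n+2\<close> and \<open>2*n+1\<close>, which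
    are no choices for \<open>i\<close>.\<close>
  have last: "v (2 * a - 1) = 2*n+2"
  proof (rule pairing_on_unique[OF e])
    have "odd (2 * a - 1)" "Suc (2 * a - 1) = 2 * a" using pos by auto
    with cycle_edge(2)[OF v(1) e p, of "2 * a - 1"] v2a
    show "{2*n+1, v (2 * a - 1)} \<in> trivial_pairing ?k" by (simp add: insert_commute)
    show "{2*n+1, 2*n+2} \<in> trivial_pairing ?k" by (simp add: trivial_pairing_Suc)
  qed
  \<comment> \<open>Even positions split and odd ones reverse. Omitting the positions
    \<open>2*a\<close> and \<open>2*a-1\<close> leaves \<open>a - 1\<close> of each kind.\<close>
  define Sp where "Sp = (\<lambda>s. v (2 * s)) ` {1..<a}"
  define Re where "Re = (\<lambda>s. v (2 * s + 1)) ` {..<a-1}"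
  define Me where "Me = {1..2*n} - v ` {1..2*a}"
  have "v ` {1..2*a} \<in> pair_components {1..2*?k} (trivial_pairing ?k) m"
    using cycle_component[OF v(1) e p] v(2) x by simp
  then have vk: "v ` {1..2*a} \<subseteq> {1..2*?k}"
    using partition_onD1[OF pair_components_partition(1)[OF e p]] by blast
  have inner: "v t \<in> {1..2*n}" if "t \<in> {1..<2*a-1}" for t
  proof -
    from that have "t \<in> {1..2*a}" "2*a \<in> {1..2*a}" "2*a-1 \<in> {1..2*a}" "t \<noteq> 2*a" "t \<noteq> 2*a-1"
      using pos by auto
    then have "v t \<noteq> 2*n+1" "v t \<noteq> 2*n+2" using eq v2a last by metis+
    moreover have "v t \<in> {1..2*?k}" using vk \<open>t \<in> {1..2*a}\<close> by blast
    ultimately show ?thesis by simp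
  qed
  have Sp: "v (2 * s) \<in> {1..2*n}" if "s \<in> {1..<a}" for s using inner[of "2 * s"] that by auto
  have Re: "v (2 * s + 1) \<in> {1..2*n}" if "s < a - 1" for s using inner[of "2 * s + 1"] that by auto
  have SpC: "Sp \<subseteq> v ` {1..2*a}" and ReC: "Re \<subseteq> v ` {1..2*a}"
    unfolding Sp_def Re_def by (auto intro!: imageI)
  have "{1..2*n} \<inter> v ` {1..2*a} \<subseteq> Sp \<union> Re"
  proof
    fix y assume "y \<in> {1..2*n} \<inter> v ` {1..2*a}"
    then obtain t where t: "t \<in> {1..2*a}" "y = v t" "y \<in> {1..2*n}" by blast
    then have t': "t \<noteq> 2 * a" "t \<noteq> 2 * a - 1" using v2a last by auto
    show "y \<in> Sp \<union> Re"
    proof (cases "even t")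
      case True
      then obtain s where "t = 2 * s" by blast
      with t t' show ?thesis by (auto simp: Sp_def)
    next
      case False
      then obtain s where "t = 2 * s + 1" by (rule oddE)
      with t t' show ?thesis by (auto simp: Re_def)
    qed
  qed
  then have Un: "{1..2*n} = Sp \<union> (Re \<union> Me)"
    using Sp Re unfolding Me_def Sp_def Re_def by auto
  have "v (2 * s) \<noteq> v (2 * s' + 1)" if "s \<in> {1..<a}" "s' < a - 1" for s s'
  proof -
    have "2 * s \<noteq> 2 * s' + 1" by presburger
    then show ?thesis using eq[of "2 * s" "2 * s' + 1"] that by auto
  qed
  then have "Sp \<inter> Re = {}" by (auto simp: Sp_def Re_def)
  then have Int: "Sp \<inter> (Re \<union> Me) = {}" "Re \<inter> Me = {}" using SpC ReC by (auto simp: Me_def)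
  have range: "{1..<2*?k-1} = {1..2*n}" by auto
  have split: "Suc (pairing_norm ?k (step (v (2 * s)))) = pairing_norm ?k m"
    "catalan_weight ?k (step (v (2 * s))) * shifted_catalan a =
      catalan_weight ?k m * (shifted_catalan s * shifted_catalan (a - s))" if "s \<in> {1..<a}" for s
    unfolding step_def x' using that Sp[OF that] range
    by (intro pairing_norm_split[OF m _ v(1) v0] catalan_weight_split[OF m _ v(1) v0]; simp)+
  have reverse: "pairing_norm ?k (step (v (2 * s + 1))) = pairing_norm ?k m"
    "catalan_weight ?k (step (v (2 * s + 1))) = catalan_weight ?k m" if "s < a - 1" for s
    unfolding step_def x' using that Re[OF that] range
    by (intro pairing_norm_reverse[OF m _ v(1) v0] catalan_weight_reverse[OF m _ v(1) v0]; simp)+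
  have merge: "pairing_norm ?k (step i) = Suc (pairing_norm ?k m)"
    "catalan_weight ?k (step i) \<le> 4 * real ?k ^ 4 * catalan_weight ?k m" if "i \<in> Me" for i
    unfolding step_def x' using that range
    by (intro pairing_norm_merge[OF m _ v(1) v0] catalan_weight_merge[OF m _ v(1) v0]; simp add: Me_def)+
  \<comment> \<open>The last block is present exactly when the cycle is a double edge: both
    neighbours of \<open>2*n+1\<close> on the cycle coincide.\<close>
  have "{2*n+1, v 1} \<in> m" using cycle_edge(1)[OF v(1) e p, of 0] v(2) by simp
  then have b_iff: "{2*n+1, 2*n+2} \<in> m \<longleftrightarrow> v 1 = v (2 * a - 1)"
    using pairing_on_unique[OF p] last by metis
  also have "\<dots> \<longleftrightarrow> a = 1" using eq[of 1 "2 * a - 1"] pos by auto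
  finally have b_iff: "{2*n+1, 2*n+2} \<in> m \<longleftrightarrow> a = 1" .
  have ca: "0 < shifted_catalan a" using shifted_catalan_pos pos by simp
  have "inj_on (\<lambda>s. v (2 * s)) {1..<a}"
    using eq by (auto intro!: inj_onI)
  then have "(\<Sum>i\<in>Sp. catalan_weight ?k (step i)) = (\<Sum>s=1..<a. catalan_weight ?k (step (v (2 * s))))"
    unfolding Sp_def by (simp add: sum.reindex)
  also have "\<dots> = (\<Sum>s=1..<a. catalan_weight ?k m / shifted_catalan a * (shifted_catalan s * shifted_catalan (a - s)))"
    using split(2) ca by (intro sum.cong) (auto simp: field_simps)
  also have "\<dots> = catalan_weight ?k m / shifted_catalan a * (\<Sum>s=1..<a. shifted_catalan s * shifted_catalan (a - s))"
    by (simp add: sum_distrib_left)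
  finally have sum: "(\<Sum>i\<in>Sp. catalan_weight ?k (step i)) =
    catalan_weight ?k m / shifted_catalan a * (\<Sum>s=1..<a. shifted_catalan s * shifted_catalan (a - s))" .
  \<comment> \<open>For \<open>a = 1\<close> nothing splits and the dashed arrow carries the whole
    weight; for \<open>a >= 2\<close> there is no dashed arrow and the Catalan convolution
    applies.\<close>
  have total: "(\<Sum>i\<in>Sp. catalan_weight ?k (step i)) +
      (if {2*n+1, 2*n+2} \<in> m then catalan_weight n (m - {{2*n+1, 2*n+2}}) else 0) = catalan_weight ?k m"
  proof (cases "a = 1")
    case True
    then show ?thesis using sum b_iff catalan_weight_remove[OF m] by simp
  next
    case False
    with pos have "2 \<le> a" by simp
    from shifted_catalan_convolution[OF this] show ?thesis using sum b_iff False ca by simp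
  qed
  show ?thesis
    by (rule that[OF Un Int _ _ _ _ _ total])
      (use split(1) reverse merge in \<open>auto simp: Sp_def Re_def\<close>)
qed

section \<open>Paths in the Weingarten graph\<close>

lemma pair_partitions_level:
  assumes "m \<in> pair_partitions k" "m \<in> pair_partitions k'"
  shows "k = k'"
proof -
  have "\<Union>m = {1..2*k}" "\<Union>m = {1..2*k'}"
    using assms partition_onD1 unfolding pair_partitions_def by blast+
  then have "{1..2*k} = {1..2*k'}" by (simp only:)
  then have "card {1..2*k} = card {1..2*k'}" by (rule arg_cong)
  then show ?thesis by simp
qed

lemma solid_arrow_iff:
  assumes "m \<in> pair_partitions (Suc n)"
  shows "solid_arrow m p \<longleftrightarrow> (\<exists>i\<in>{1..2*n}. p = perm_act (Transposition.transpose i (2*n+1)) m)"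
proof
  assume "solid_arrow m p"
  then obtain k i where ki: "m \<in> pair_partitions k" "1 \<le> i" "i < 2*k-1"
      "p = perm_act (Transposition.transpose i (2*k-1)) m"
    by (auto simp: solid_arrow_def)
  have "k = Suc n" using pair_partitions_level[OF ki(1) assms] .
  with ki show "\<exists>i\<in>{1..2*n}. p = perm_act (Transposition.transpose i (2*n+1)) m"
    by (intro bexI[of _ i]) auto
next
  assume "\<exists>i\<in>{1..2*n}. p = perm_act (Transposition.transpose i (2*n+1)) m"
  then obtain i where i: "i \<in> {1..2*n}" "p = perm_act (Transposition.transpose i (2*n+1)) m" by blast
  then show "solid_arrow m p"
    unfolding solid_arrow_def using assms by (intro exI[of _ "Suc n"] exI[of _ i]) auto
qed

lemma dashed_arrow_iff:
  assumes "m \<in> pair_partitions (Suc n)"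
  shows "dashed_arrow m p \<longleftrightarrow> {2*n+1, 2*n+2} \<in> m \<and> p = m - {{2*n+1, 2*n+2}}"
proof
  assume "dashed_arrow m p"
  then obtain k where k: "m \<in> pair_partitions k" "{2*k-1, 2*k} \<in> m" "p = m - {{2*k-1, 2*k}}"
    unfolding dashed_arrow_def by blast
  have "k = Suc n" using pair_partitions_level[OF k(1) assms] .
  with k show "{2*n+1, 2*n+2} \<in> m \<and> p = m - {{2*n+1, 2*n+2}}" by simp
next
  assume "{2*n+1, 2*n+2} \<in> m \<and> p = m - {{2*n+1, 2*n+2}}"
  then show "dashed_arrow m p"
    unfolding dashed_arrow_def using assms by (intro exI[of _ "Suc n"]) simp
qed

lemma pair_partitions_step:
  assumes "m \<in> pair_partitions (Suc n)" "i \<in> {1..2*n}"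
  shows "perm_act (Transposition.transpose i (2*n+1)) m \<in> pair_partitions (Suc n)"
  using pair_partitions_transpose[OF assms(1), of i] assms(2) by simp

text \<open>The target of a solid arrow has the level of its source, that of a dashed arrow the
  level below. Paths count the two kinds of steps separately, so no step may count for both.\<close>

lemma not_solid_and_dashed:
  assumes "m \<in> pair_partitions (Suc n)" "solid_arrow m p" "dashed_arrow m p"
  shows False
proof -
  have "p \<in> pair_partitions (Suc n)"
    using assms(1,2) pair_partitions_step by (auto simp: solid_arrow_iff)
  moreover have "p \<in> pair_partitions n"
    using assms(1,3) pair_partitions_remove by (auto simp: dashed_arrow_iff)
  ultimately show False using pair_partitions_level[of p "Suc n" n] by simp
qed

text \<open>The new mate of \<open>2*n+1\<close> determines \<open>i\<close>: it is the old mate of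
  \<open>i\<close>, or \<open>i\<close> itself when the arrow is a loop. Paths record vertices, not
  arrows, so injectivity is what lets them be counted arrow by arrow.\<close>

lemma step_inj:
  assumes "m \<in> pair_partitions (Suc n)"
  shows "inj_on (\<lambda>i. perm_act (Transposition.transpose i (2*n+1)) m) {1..2*n}"
proof -
  let ?x = "2*n+1"
  have m: "pairing_on {1..2*Suc n} m" using assms by (simp add: pair_partitions_iff)
  have mate: "mate (perm_act (Transposition.transpose i ?x) m) ?x =
      (if mate m i = ?x then i else mate m i)" if "i \<in> {1..2*n}" for i
  proof (rule mate_eq)
    show "pairing_on {1..2*Suc n} (perm_act (Transposition.transpose i ?x) m)"
      using pair_partitions_step[OF assms that] by (simp add: pair_partitions_iff)
    have i: "{i, mate m i} \<in> m" "mate m i \<noteq> i"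
      using mate_edge[OF m, of i] mate_neq[OF m, of i] that by auto
    then show "{?x, if mate m i = ?x then i else mate m i} \<in> perm_act (Transposition.transpose i ?x) m"
      by (auto simp: mem_perm_act_transpose)
  qed
  show ?thesis
  proof (rule inj_onI)
    fix i i' assume i: "i \<in> {1..2*n}" "i' \<in> {1..2*n}"
      "perm_act (Transposition.transpose i ?x) m = perm_act (Transposition.transpose i' ?x) m"
    then have "(if mate m i = ?x then i else mate m i) = (if mate m i' = ?x then i' else mate m i')"
      using mate by metis
    moreover have "i \<noteq> ?x" "i' \<noteq> ?x" using i by auto
    ultimately show "i = i'" using mate_mate[OF m] by (metis (full_types))
  qed
qed

section \<open>Recursion for the number of paths\<close>

lemma card_steps_Cons:
  "card {t. t < Suc L \<and> Q ((m # p) ! t) ((m # p) ! Suc t)} =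
    of_bool (Q m (p ! 0)) + card {t. t < L \<and> Q (p ! t) (p ! Suc t)}"
proof -
  let ?B = "{t. t < L \<and> Q (p ! t) (p ! Suc t)}"
  have "{t. t < Suc L \<and> Q ((m # p) ! t) ((m # p) ! Suc t)} = {t. t = 0 \<and> Q m (p ! 0)} \<union> Suc ` ?B"
    by (auto simp: less_Suc_eq_0_disj)
  also have "card \<dots> = card {t. t = (0::nat) \<and> Q m (p ! 0)} + card (Suc ` ?B)"
    by (rule card_Un_disjoint) auto
  also have "card {t. t = (0::nat) \<and> Q m (p ! 0)} = of_bool (Q m (p ! 0))" by simp
  also have "card (Suc ` ?B) = card ?B" by (rule card_image) simp
  finally show ?thesis .
qed

lemma weingarten_paths_Cons:
  assumes m: "m \<in> pair_partitions (Suc n)"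
  shows "m # p \<in> weingarten_paths (Suc n) m l \<longleftrightarrow>
    (solid_arrow m (p ! 0) \<and> l > 0 \<and> p \<in> weingarten_paths (Suc n) (p ! 0) (l - 1)) \<or>
    (dashed_arrow m (p ! 0) \<and> p \<in> weingarten_paths n (p ! 0) l)"
proof -
  let ?S = "card {t. t < l + n \<and> solid_arrow (p ! t) (p ! Suc t)}"
  let ?D = "card {t. t < l + n \<and> dashed_arrow (p ! t) (p ! Suc t)}"
  have all: "(\<forall>t<Suc L. R t) \<longleftrightarrow> R 0 \<and> (\<forall>t<L. R (Suc t))" for R L
    using less_Suc_eq_0_disj by auto
  have 1: "m # p \<in> weingarten_paths (Suc n) m l \<longleftrightarrow>
     length p = l + n + 1 \<and> p ! (l + n) = {} \<and> (solid_arrow m (p ! 0) \<or> dashed_arrow m (p ! 0)) \<and>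
     (\<forall>t<l + n. solid_arrow (p ! t) (p ! Suc t) \<or> dashed_arrow (p ! t) (p ! Suc t)) \<and>
     of_bool (solid_arrow m (p ! 0)) + ?S = l \<and> of_bool (dashed_arrow m (p ! 0)) + ?D = Suc n"
    unfolding weingarten_paths_def mem_Collect_eq add_Suc_right card_steps_Cons all by simp
  consider "solid_arrow m (p ! 0)" "\<not> dashed_arrow m (p ! 0)"
    | "\<not> solid_arrow m (p ! 0)" "dashed_arrow m (p ! 0)"
    | "\<not> solid_arrow m (p ! 0)" "\<not> dashed_arrow m (p ! 0)"
    using not_solid_and_dashed[OF m] by blast
  then show ?thesis
  proof cases
    case 1
    show ?thesis
    proof (cases l)
      case 0
      then show ?thesis unfolding \<open>m # p \<in> _ \<longleftrightarrow> _\<close> using 1 by simp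
    next
      case (Suc l')
      have *: "l + n = l' + Suc n" using Suc by simp
      show ?thesis unfolding \<open>m # p \<in> _ \<longleftrightarrow> _\<close> unfolding weingarten_paths_def mem_Collect_eq *
        using 1 by (auto simp: Suc)
    qed
  next
    case 2
    then show ?thesis unfolding \<open>m # p \<in> _ \<longleftrightarrow> _\<close> unfolding weingarten_paths_def mem_Collect_eq
      by auto
  next
    case 3
    then show ?thesis unfolding \<open>m # p \<in> _ \<longleftrightarrow> _\<close> by simp
  qed
qed

text \<open>The empty pairing has no outgoing arrow.\<close>

lemma weingarten_paths_0: "weingarten_paths 0 {} l = (if l = 0 then {[{}]} else {})"
proof -
  have 0: "k = 0" if "{} \<in> pair_partitions k" for k
    using that by (auto simp: pair_partitions_def partition_on_def)
  have "\<not> solid_arrow {} p" for p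
  proof
    assume "solid_arrow {} p"
    then obtain k i where "{} \<in> pair_partitions k" "i < 2*k-1" unfolding solid_arrow_def by blast
    then show False using 0[of k] by simp
  qed
  moreover have "\<not> dashed_arrow {} p" for p
  proof
    assume "dashed_arrow {} p"
    then obtain k where "{} \<in> pair_partitions k" "1 \<le> k" unfolding dashed_arrow_def by blast
    then show False using 0[of k] by simp
  qed
  ultimately have no: "p \<notin> weingarten_paths 0 {} (Suc l')" for p l'
    unfolding weingarten_paths_def mem_Collect_eq by (metis add_Suc zero_less_Suc)
  show ?thesis
  proof (cases l)
    case 0
    then show ?thesis by (auto simp: weingarten_paths_def length_Suc_conv)
  next
    case (Suc l')
    then show ?thesis using no[of _ l'] by (simp add: set_eq_iff)
  qed
qed

lemma hd_weingarten_paths: "p \<in> weingarten_paths k m l \<Longrightarrow> p ! 0 = m"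
  by (simp add: weingarten_paths_def)

lemma weingarten_paths_Suc:
  assumes m: "m \<in> pair_partitions (Suc n)"
  shows "weingarten_paths (Suc n) m l =
    (\<Union>i\<in>{1..2*n}. (#) m ` (if l = 0 then {} else
        weingarten_paths (Suc n) (perm_act (Transposition.transpose i (2*n+1)) m) (l - 1))) \<union>
    (#) m ` (if {2*n+1, 2*n+2} \<in> m then weingarten_paths n (m - {{2*n+1, 2*n+2}}) l else {})"
    (is "?L = ?R")
proof (rule set_eqI)
  fix p
  have iff: "m # p' \<in> ?L \<longleftrightarrow> m # p' \<in> ?R" for p'
  proof -
    have "m # p' \<in> ?R \<longleftrightarrow> (\<exists>i\<in>{1..2*n}. l > 0 \<and>
          p' \<in> weingarten_paths (Suc n) (perm_act (Transposition.transpose i (2*n+1)) m) (l - 1)) \<or>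
        ({2*n+1, 2*n+2} \<in> m \<and> p' \<in> weingarten_paths n (m - {{2*n+1, 2*n+2}}) l)"
      by auto
    also have "\<dots> \<longleftrightarrow> m # p' \<in> ?L"
    proof -
      have *: "p' \<in> weingarten_paths k q l' \<longleftrightarrow> p' ! 0 = q \<and> p' \<in> weingarten_paths k (p' ! 0) l'" for k q l'
        using hd_weingarten_paths[of p' k q l'] by auto
      show ?thesis
        unfolding weingarten_paths_Cons[OF m] solid_arrow_iff[OF m] dashed_arrow_iff[OF m]
        by (subst *, subst (2) *) blast
    qed
    finally show ?thesis by simp
  qed
  have "\<exists>p'. p = m # p'" if "p \<in> ?L"
  proof (cases p)
    case Nil
    with that show ?thesis by (simp add: weingarten_paths_def)
  next
    case (Cons a p')
    with that show ?thesis by (simp add: weingarten_paths_def)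
  qed
  moreover have "\<exists>p'. p = m # p'" if "p \<in> ?R" using that by blast
  ultimately show "p \<in> ?L \<longleftrightarrow> p \<in> ?R" using iff by blast
qed

lemma finite_weingarten_paths: "m \<in> pair_partitions k \<Longrightarrow> finite (weingarten_paths k m l)"
proof (induction "l + k" arbitrary: l k m rule: less_induct)
  case less
  show ?case
  proof (cases k)
    case 0
    then have "m = {}" using less.prems by (auto simp: pair_partitions_def partition_on_def)
    then show ?thesis using weingarten_paths_0[of l] 0 by simp
  next
    case (Suc n)
    have m: "m \<in> pair_partitions (Suc n)" using less.prems Suc by simp
    have 1: "finite (weingarten_paths (Suc n) (perm_act (Transposition.transpose i (2*n+1)) m) (l - 1))"
      if "l \<noteq> 0" "i \<in> {1..2*n}" for i
      using that Suc by (intro less.hyps pair_partitions_step[OF m]) auto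
    have 2: "finite (weingarten_paths n (m - {{2*n+1, 2*n+2}}) l)" if "{2*n+1, 2*n+2} \<in> m"
      using that Suc by (intro less.hyps pair_partitions_remove[OF m]) auto
    show ?thesis unfolding Suc weingarten_paths_Suc[OF m] using 1 2 by auto
  qed
qed

text \<open>Paths with different first arrows are told apart by their second vertex: by
  \<open>step_inj\<close> for two solid arrows, by the level for a solid and a dashed one.\<close>

lemma card_weingarten_paths_Suc:
  assumes m: "m \<in> pair_partitions (Suc n)"
  shows "card (weingarten_paths (Suc n) m (Suc l)) =
    (\<Sum>i\<in>{1..2*n}. card (weingarten_paths (Suc n) (perm_act (Transposition.transpose i (2*n+1)) m) l)) +
    (if {2*n+1, 2*n+2} \<in> m then card (weingarten_paths n (m - {{2*n+1, 2*n+2}}) (Suc l)) else 0)"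
proof -
  let ?step = "\<lambda>i. perm_act (Transposition.transpose i (2*n+1)) m"
  let ?W = "\<lambda>i. (#) m ` weingarten_paths (Suc n) (?step i) l"
  let ?D = "(#) m ` (if {2*n+1, 2*n+2} \<in> m then weingarten_paths n (m - {{2*n+1, 2*n+2}}) (Suc l) else {})"
  have fin: "finite (?W i)" if "i \<in> {1..2*n}" for i
    using finite_weingarten_paths[OF pair_partitions_step[OF m that]] by simp
  have finD: "finite ?D"
    using finite_weingarten_paths pair_partitions_remove[OF m] by simp
  have disj: "?W i \<inter> ?W i' = {}" if "i \<in> {1..2*n}" "i' \<in> {1..2*n}" "i \<noteq> i'" for i i'
  proof -
    have "?step i \<noteq> ?step i'" using inj_onD[OF step_inj[OF m]] that by blast
    then show ?thesis using hd_weingarten_paths by blast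
  qed
  have "?W i \<inter> ?D = {}" if "i \<in> {1..2*n}" for i
  proof (cases "{2*n+1, 2*n+2} \<in> m")
    case True
    have "?step i \<noteq> m - {{2*n+1, 2*n+2}}"
    proof
      assume "?step i = m - {{2*n+1, 2*n+2}}"
      then have "?step i \<in> pair_partitions n" using pair_partitions_remove[OF m True] by (simp only:)
      from pair_partitions_level[OF pair_partitions_step[OF m that] this] show False by simp
    qed
    then have "p \<notin> weingarten_paths (Suc n) (?step i) l \<or> p \<notin> weingarten_paths n (m - {{2*n+1, 2*n+2}}) (Suc l)" for p
      using hd_weingarten_paths by metis
    then show ?thesis by auto
  qed simp
  then have "card ((\<Union>i\<in>{1..2*n}. ?W i) \<union> ?D) = card (\<Union>i\<in>{1..2*n}. ?W i) + card ?D"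
    using fin finD by (intro card_Un_disjoint) (blast intro: finite_UN_I)+
  also have "card (\<Union>i\<in>{1..2*n}. ?W i) = (\<Sum>i\<in>{1..2*n}. card (?W i))"
    using fin disj by (intro card_UN_disjoint) auto
  also have "\<dots> = (\<Sum>i\<in>{1..2*n}. card (weingarten_paths (Suc n) (?step i) l))"
    by (intro sum.cong card_image) auto
  also have "card ?D = (if {2*n+1, 2*n+2} \<in> m then card (weingarten_paths n (m - {{2*n+1, 2*n+2}}) (Suc l)) else 0)"
    by (simp add: card_image)
  finally show ?thesis using weingarten_paths_Suc[OF m, of "Suc l"] by simp
qed

lemma card_weingarten_paths_Suc_0:
  assumes m: "m \<in> pair_partitions (Suc n)"
  shows "card (weingarten_paths (Suc n) m 0) =
    (if {2*n+1, 2*n+2} \<in> m then card (weingarten_paths n (m - {{2*n+1, 2*n+2}}) 0) else 0)"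
  using weingarten_paths_Suc[OF m, of 0] by (simp add: card_image)

section \<open>Shortest paths and paths with excess\<close>

lemma pair_partitions_0: "pair_partitions 0 = {{}}"
  by (auto simp: pair_partitions_def partition_on_def)

lemma pairing_norm_0: "pairing_norm 0 m = 0"
  by (simp add: pairing_norm_def)

lemma catalan_weight_0: "catalan_weight 0 m = 1"
  by (simp add: catalan_weight_def pairing_components_def)

text \<open>A solid arrow lowers the norm by at most one, a dashed arrow preserves it, and the norm
  of the empty pairing is 0.\<close>

lemma weingarten_paths_below_norm:
  "m \<in> pair_partitions k \<Longrightarrow> l < pairing_norm k m \<Longrightarrow> card (weingarten_paths k m l) = 0"
proof (induction "l + k" arbitrary: l k m rule: less_induct)
  case less
  show ?case
  proof (cases k)
    case 0
    then show ?thesis using less.prems by (simp add: pairing_norm_0)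
  next
    case (Suc n)
    have m: "m \<in> pair_partitions (Suc n)" and l: "l < pairing_norm (Suc n) m" using less.prems Suc by auto
    let ?step = "\<lambda>i. perm_act (Transposition.transpose i (2*n+1)) m"
    have down: "card (weingarten_paths n (m - {{2*n+1, 2*n+2}}) l) = 0" if "{2*n+1, 2*n+2} \<in> m"
      using that Suc l pair_partitions_remove[OF m that] pairing_norm_remove[OF m that]
      by (intro less.hyps) auto
    show ?thesis
    proof (cases l)
      case 0
      show ?thesis using down unfolding Suc 0 card_weingarten_paths_Suc_0[OF m] by simp
    next
      case (Suc l')
      obtain Sp Re Me where S: "{1..2*n} = Sp \<union> (Re \<union> Me)"
        "\<And>i. i \<in> Sp \<Longrightarrow> Suc (pairing_norm (Suc n) (?step i)) = pairing_norm (Suc n) m"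
        "\<And>i. i \<in> Re \<Longrightarrow> pairing_norm (Suc n) (?step i) = pairing_norm (Suc n) m"
        "\<And>i. i \<in> Me \<Longrightarrow> pairing_norm (Suc n) (?step i) = Suc (pairing_norm (Suc n) m)"
        by (rule solid_steps[OF m]) blast
      have "card (weingarten_paths (Suc n) (?step i) l') = 0" if i: "i \<in> {1..2*n}" for i
      proof (rule less.hyps[OF _ pair_partitions_step[OF m i]])
        show "l' + Suc n < l + k" using Suc \<open>k = Suc n\<close> by simp
        have "i \<in> Sp \<or> i \<in> Re \<or> i \<in> Me" using i S(1) by blast
        then have "pairing_norm (Suc n) m \<le> Suc (pairing_norm (Suc n) (?step i))"
          using S(2-4)[of i] by fastforce
        then show "l' < pairing_norm (Suc n) (?step i)" using l Suc by simp
      qed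
      then show ?thesis
        using down unfolding \<open>k = Suc n\<close> Suc card_weingarten_paths_Suc[OF m] by simp
    qed
  qed
qed

text \<open>After a reversal or a merge fewer solid steps remain than the norm demands, so only
  splits and the dashed arrow count. The weight obeys the same recursion by the Catalan
  convolution.\<close>

lemma card_geodesic_weingarten_paths:
  "m \<in> pair_partitions k \<Longrightarrow> real (card (weingarten_paths k m (pairing_norm k m))) = catalan_weight k m"
proof (induction "pairing_norm k m + k" arbitrary: k m rule: less_induct)
  case less
  show ?case
  proof (cases k)
    case 0
    then show ?thesis
      using less.prems weingarten_paths_0[of 0]
      by (simp add: pair_partitions_0 pairing_norm_0 catalan_weight_0)
  next
    case (Suc n)
    have m: "m \<in> pair_partitions (Suc n)" using less.prems Suc by auto
    let ?step = "\<lambda>i. perm_act (Transposition.transpose i (2*n+1)) m"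
    let ?down = "m - {{2*n+1, 2*n+2}}"
    obtain Sp Re Me where S: "{1..2*n} = Sp \<union> (Re \<union> Me)" "Sp \<inter> (Re \<union> Me) = {}"
      "\<And>i. i \<in> Sp \<Longrightarrow> Suc (pairing_norm (Suc n) (?step i)) = pairing_norm (Suc n) m"
      "\<And>i. i \<in> Re \<Longrightarrow> pairing_norm (Suc n) (?step i) = pairing_norm (Suc n) m"
      "\<And>i. i \<in> Me \<Longrightarrow> pairing_norm (Suc n) (?step i) = Suc (pairing_norm (Suc n) m)"
      "(\<Sum>i\<in>Sp. catalan_weight (Suc n) (?step i)) +
        (if {2*n+1, 2*n+2} \<in> m then catalan_weight n ?down else 0) = catalan_weight (Suc n) m"
      by (rule solid_steps[OF m]) blast
    have fin: "finite Sp" "finite (Re \<union> Me)" using S(1) finite_atLeastAtMost finite_Un by metis+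
    have down: "real (card (weingarten_paths n ?down (pairing_norm (Suc n) m))) = catalan_weight n ?down"
      if b: "{2*n+1, 2*n+2} \<in> m"
      using less.hyps[OF _ pair_partitions_remove[OF m b]] pairing_norm_remove[OF m b] Suc by simp
    show ?thesis
    proof (cases "pairing_norm (Suc n) m")
      case 0
      \<comment> \<open>Norm 0 excludes splits, so the weight identity reduces to the dashed
        arrow.\<close>
      then have "Sp = {}" using S(3) by force
      then show ?thesis
        using down S(6) unfolding Suc 0 card_weingarten_paths_Suc_0[OF m] by (auto split: if_splits)
    next
      case (Suc r)
      have "real (card (weingarten_paths (Suc n) (?step i) r)) = catalan_weight (Suc n) (?step i)"
        if "i \<in> Sp" for i
      proof -
        have "?step i \<in> pair_partitions (Suc n)" "pairing_norm (Suc n) (?step i) = r"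
          using pair_partitions_step[OF m, of i] that S(1) S(3)[OF that] Suc by (blast, simp)
        then show ?thesis using less.hyps[of "Suc n" "?step i"] Suc \<open>k = Suc n\<close> by simp
      qed
      then have 1: "(\<Sum>i\<in>Sp. real (card (weingarten_paths (Suc n) (?step i) r))) =
          (\<Sum>i\<in>Sp. catalan_weight (Suc n) (?step i))" by (intro sum.cong refl)
      have "card (weingarten_paths (Suc n) (?step i) r) = 0" if "i \<in> Re \<union> Me" for i
      proof (rule weingarten_paths_below_norm)
        show "?step i \<in> pair_partitions (Suc n)" using pair_partitions_step[OF m] that S(1) by blast
        show "r < pairing_norm (Suc n) (?step i)" using S(4,5)[of i] that Suc by auto
      qed
      then have 2: "(\<Sum>i\<in>Re \<union> Me. real (card (weingarten_paths (Suc n) (?step i) r))) = 0" by simp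
      have "real (\<Sum>i\<in>{1..2*n}. card (weingarten_paths (Suc n) (?step i) r)) =
          (\<Sum>i\<in>Sp. catalan_weight (Suc n) (?step i))"
        unfolding S(1) of_nat_sum sum.union_disjoint[OF fin S(2)] of_nat_add using 1 2 by linarith
      then show ?thesis
        using down S(6) unfolding \<open>k = Suc n\<close> Suc card_weingarten_paths_Suc[OF m] by auto
    qed
  qed
qed

text \<open>Along a path with excess \<open>g\<close>, consider the first step that does not decrease
  the norm.  It occurs among at most \<open>2K\<close> positions and has at most \<open>2K\<close> choices; a reversal costs
  one unit of excess and leaves the weight unchanged, a merge costs two units and multiplies
  the weight by at most \<open>4 K^4\<close>.\<close>

lemma card_weingarten_paths_le:
  assumes "1 \<le> K"
  shows "m \<in> pair_partitions k \<Longrightarrow> k \<le> K \<Longrightarrow>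
    real (card (weingarten_paths k m (pairing_norm k m + g))) \<le> (12 * real K ^ 3) ^ g * catalan_weight k m"
proof (induction g arbitrary: k m rule: less_induct)
  case (less g)
  show ?case
  proof (cases g)
    case 0
    then show ?thesis using card_geodesic_weingarten_paths[OF less.prems(1)] by simp
  next
    case (Suc h)
    \<comment> \<open>Two nested inductions: the outer one, on the excess, handles what follows the
      first reversal or merge; the inner one, on the norm plus \<open>k\<close>, handles the splits
      and dashed arrows before it. \<open>K\<close> is fixed because \<open>k\<close> falls along
      dashed arrows.\<close>
    note outer = less.IH
    define C where "C = 12 * real K ^ 3"
    have C0: "0 \<le> C" by (simp add: C_def)
    \<comment> \<open>Relative to the weight, \<open>R\<close> bounds the paths after a reversal
      (excess \<open>h\<close> left) or a merge (excess \<open>h - 1\<close> left, impossible for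
      \<open>h = 0\<close>); \<open>E\<close> accounts for at most \<open>2 K\<close> such
      arrows.\<close>
    define R where "R = C ^ h + (if h = 0 then 0 else 4 * real K ^ 4 * C ^ (h - 1))"
    define E where "E = 2 * real K * R"
    have R0: "0 \<le> R" using C0 by (simp add: R_def)
    then have E0: "0 \<le> E" by (simp add: E_def)
    \<comment> \<open>The factor in front of \<open>E\<close> counts the positions of the first
      reversal or merge: every split and every dashed arrow lowers it by one.\<close>
    have inner: "real (card (weingarten_paths k m (pairing_norm k m + Suc h)))
        \<le> real (pairing_norm k m + k) * E * catalan_weight k m"
      if "m \<in> pair_partitions k" "k \<le> K" for k m
      using that
    proof (induction "pairing_norm k m + k" arbitrary: k m rule: less_induct)
      case (less k m)
      show ?case
      proof (cases k)
        case 0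
        then show ?thesis using less.prems weingarten_paths_0[of "Suc h"]
          by (simp add: pair_partitions_0 pairing_norm_0)
      next
        case (Suc n)
        have m: "m \<in> pair_partitions (Suc n)" and nK: "Suc n \<le> K" using less.prems Suc by auto
        let ?step = "\<lambda>i. perm_act (Transposition.transpose i (2*n+1)) m"
        let ?down = "m - {{2*n+1, 2*n+2}}"
        let ?N = "pairing_norm (Suc n) m"
        let ?w = "catalan_weight (Suc n) m"
        let ?f = "\<lambda>i. real (card (weingarten_paths (Suc n) (?step i) (?N + h)))"
        have w0: "0 \<le> ?w" using catalan_weight_pos[OF m] by simp
        define s where "s = real (?N + n)"
        have s0: "0 \<le> s" by (simp add: s_def)
        obtain Sp Re Me where S: "{1..2*n} = Sp \<union> (Re \<union> Me)" "Sp \<inter> (Re \<union> Me) = {}"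
          "\<And>i. i \<in> Sp \<Longrightarrow> Suc (pairing_norm (Suc n) (?step i)) = ?N"
          "\<And>i. i \<in> Re \<Longrightarrow> pairing_norm (Suc n) (?step i) = ?N"
          "\<And>i. i \<in> Re \<Longrightarrow> catalan_weight (Suc n) (?step i) = ?w"
          "\<And>i. i \<in> Me \<Longrightarrow> pairing_norm (Suc n) (?step i) = Suc ?N"
          "\<And>i. i \<in> Me \<Longrightarrow> catalan_weight (Suc n) (?step i) \<le> 4 * real (Suc n) ^ 4 * ?w"
          "(\<Sum>i\<in>Sp. catalan_weight (Suc n) (?step i)) +
            (if {2*n+1, 2*n+2} \<in> m then catalan_weight n ?down else 0) = ?w"
          by (rule solid_steps[OF m]) blast
        have fin: "finite Sp" "finite (Re \<union> Me)" using S(1) finite_atLeastAtMost finite_Un by metis+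
        have step: "?step i \<in> pair_partitions (Suc n)" if "i \<in> Sp \<union> (Re \<union> Me)" for i
          using pair_partitions_step[OF m] that S(1) by blast
        have Sp: "?f i \<le> s * E * catalan_weight (Suc n) (?step i)" if i: "i \<in> Sp" for i
        proof -
          let ?N' = "pairing_norm (Suc n) (?step i)"
          have N: "?N = Suc ?N'" using S(3)[OF i] by simp
          then have "?N' + Suc n < pairing_norm k m + k" using Suc by simp
          from less.hyps[OF this step nK] i
          show ?thesis by (simp add: N s_def)
        qed
        have bad: "?f i \<le> R * ?w" if i: "i \<in> Re \<union> Me" for i
        proof (cases "i \<in> Re")
          case True
          have "?f i \<le> C ^ h * ?w"
            using outer[of h "?step i" "Suc n"] \<open>g = Suc h\<close> step[of i] i nK S(4,5)[OF True]
            by (simp add: C_def)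
          also have "\<dots> \<le> R * ?w" using w0 C0 by (intro mult_right_mono) (simp_all add: R_def)
          finally show ?thesis .
        next
          case False
          with i have Me: "i \<in> Me" by blast
          show ?thesis
          proof (cases h)
            case 0
            \<comment> \<open>A merge uses two units of excess and only one is available.\<close>
            have "?f i = 0"
              using weingarten_paths_below_norm[OF step[of i], of ?N] S(6)[OF Me] i 0 by simp
            then show ?thesis using R0 w0 by simp
          next
            case h: (Suc h')
            have "?f i \<le> C ^ h' * catalan_weight (Suc n) (?step i)"
              using outer[of h' "?step i" "Suc n"] \<open>g = Suc h\<close> step[of i] i nK S(6)[OF Me] h
              by (simp add: C_def)
            also have "\<dots> \<le> C ^ h' * (4 * real (Suc n) ^ 4 * ?w)"
              using S(7)[OF Me] C0 by (intro mult_left_mono) auto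
            also have "\<dots> \<le> C ^ h' * (4 * real K ^ 4 * ?w)"
              using C0 w0 nK by (intro mult_left_mono mult_right_mono power_mono) auto
            also have "\<dots> = (4 * real K ^ 4 * C ^ h') * ?w" by simp
            also have "\<dots> \<le> R * ?w" using w0 C0 h by (intro mult_right_mono) (simp_all add: R_def)
            finally show ?thesis .
          qed
        qed
        have "card (Re \<union> Me) \<le> card {1..2*n}" unfolding S(1) using fin by (intro card_mono) auto
        then have "real (card (Re \<union> Me)) \<le> 2 * real K" using nK by simp
        then have "real (card (Re \<union> Me)) * (R * ?w) \<le> 2 * real K * (R * ?w)"
          using R0 w0 by (intro mult_right_mono) auto
        then have bads: "(\<Sum>i\<in>Re \<union> Me. ?f i) \<le> E * ?w"
          using sum_bounded_above[of "Re \<union> Me" ?f "R * ?w"] bad by (fastforce simp: E_def mult.assoc)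
        have goods: "(\<Sum>i\<in>Sp. ?f i) \<le> s * E * (\<Sum>i\<in>Sp. catalan_weight (Suc n) (?step i))"
          unfolding sum_distrib_left by (rule sum_mono) (rule Sp)
        have down: "(if {2*n+1, 2*n+2} \<in> m then real (card (weingarten_paths n ?down (?N + Suc h))) else 0)
            \<le> s * E * (if {2*n+1, 2*n+2} \<in> m then catalan_weight n ?down else 0)"
        proof (cases "{2*n+1, 2*n+2} \<in> m")
          case True
          have N: "pairing_norm n ?down = ?N" using pairing_norm_remove[OF m True] .
          then have "pairing_norm n ?down + n < pairing_norm k m + k" using Suc by simp
          from less.hyps[OF this pair_partitions_remove[OF m True]] nK True
          show ?thesis unfolding N s_def by simp
        qed simp
        have "real (card (weingarten_paths (Suc n) m (?N + Suc h))) =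
            (\<Sum>i\<in>Sp. ?f i) + (\<Sum>i\<in>Re \<union> Me. ?f i) +
            (if {2*n+1, 2*n+2} \<in> m then real (card (weingarten_paths n ?down (?N + Suc h))) else 0)"
          unfolding add_Suc_right card_weingarten_paths_Suc[OF m] S(1)
          by (simp add: sum.union_disjoint[OF fin S(2)] del: Un_iff)
        \<comment> \<open>Splits and the dashed arrow carry the common factor \<open>s * E\<close>,
          and their weights add up to the weight of \<open>m\<close>.\<close>
        also have "\<dots> \<le> s * E * ?w + E * ?w"
          using goods bads down unfolding S(8)[symmetric] distrib_left by linarith
        also have "\<dots> = real (?N + Suc n) * E * ?w" by (simp add: s_def algebra_simps)
        finally show ?thesis unfolding Suc .
      qed
    qed
    have w0: "0 \<le> catalan_weight k m" using catalan_weight_pos[OF less.prems(1)] by simp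
    have K: "1 \<le> real K" using assms by simp
    have "pairing_norm k m + k \<le> 2 * K" using less.prems(2) by (simp add: pairing_norm_def)
    then have NK: "real (pairing_norm k m + k) \<le> 2 * real K" by linarith
    have "real (pairing_norm k m + k) * E \<le> (2 * real K) * E"
      using E0 NK by (intro mult_right_mono)
    also have "\<dots> = 4 * real K ^ 2 * R" by (simp add: E_def power2_eq_square)
    also have "\<dots> \<le> C ^ Suc h"
    proof (cases h)
      case 0
      have "real K ^ 2 \<le> real K ^ 3" using K by (intro power_increasing) auto
      moreover have "0 \<le> real K ^ 3" by simp
      ultimately have "real K ^ 2 \<le> 3 * real K ^ 3" by linarith
      then show ?thesis using 0 by (simp add: R_def C_def)
    next
      case h: (Suc h')
      \<comment> \<open>With \<open>C = 12 K^3\<close> the claim reads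
        \<open>48 K^5 + 16 K^6 \<le> 144 K^6\<close>; after division by 16 this is
        \<open>3 K^5 \<le> 8 K^6\<close>.\<close>
      have "real K ^ 5 \<le> real K ^ 6" using K by (intro power_increasing) auto
      moreover have "0 \<le> real K ^ 6" by simp
      ultimately have "3 * real K ^ 5 \<le> 8 * real K ^ 6" by linarith
      then have "4 * real K ^ 2 * (C + 4 * real K ^ 4) \<le> C * C"
        by (simp add: C_def algebra_simps flip: power_add)
      then have "4 * real K ^ 2 * (C + 4 * real K ^ 4) * C ^ h' \<le> C * C * C ^ h'"
        using C0 by (intro mult_right_mono) auto
      then show ?thesis using h by (simp add: R_def algebra_simps)
    qed
    finally have "real (pairing_norm k m + k) * E * catalan_weight k m \<le> C ^ Suc h * catalan_weight k m"
      using w0 by (rule mult_right_mono)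
    with inner[OF less.prems] show ?thesis by (simp add: Suc C_def)
  qed
qed

section \<open>The series expansion\<close>

definition path_series :: "nat \<Rightarrow> nat \<Rightarrow> nat set set \<Rightarrow> real" where
  "path_series d k m = (\<Sum>l. real (card (weingarten_paths k m l)) * (- 1 / real d) ^ l)"

lemma excess_le:
  assumes "m \<in> pair_partitions k"
  shows "real (card (weingarten_paths k m (pairing_norm k m + g))) \<le>
    (12 * real k ^ 3) ^ g * real (card (weingarten_paths k m (pairing_norm k m)))"
proof (cases "k = 0")
  case True
  \<comment> \<open>The base of the power is 0 here: \<open>0^0 = 1\<close> covers
    \<open>g = 0\<close>, and there are no paths with solid arrows.\<close>
  then have "m = {}" using assms by (simp add: pair_partitions_0)
  then show ?thesis
    using True by (cases "g = 0") (simp_all add: pairing_norm_0 weingarten_paths_0)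
next
  case False
  then show ?thesis
    using card_weingarten_paths_le[of k m k g] assms card_geodesic_weingarten_paths[OF assms] by simp
qed

lemma summable_excess:
  assumes m: "m \<in> pair_partitions k" and d: "12 * real k ^ 3 < real d"
  shows "summable (\<lambda>g. real (card (weingarten_paths k m (pairing_norm k m + g))) * (- 1 / real d) ^ g)"
proof (rule summable_comparison_test')
  let ?w = "real (card (weingarten_paths k m (pairing_norm k m)))"
  have d0: "0 < real d" using d by (smt (verit) of_nat_0_le_iff zero_le_power mult_nonneg_nonneg)
  show "summable (\<lambda>g. (12 * real k ^ 3 / real d) ^ g * ?w)"
    using d d0 by (intro summable_mult2 summable_geometric) simp
  fix g :: nat
  have "real (card (weingarten_paths k m (pairing_norm k m + g))) * (1 / real d) ^ g
      \<le> (12 * real k ^ 3) ^ g * ?w * (1 / real d) ^ g"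
    using excess_le[OF m] by (intro mult_right_mono) auto
  also have "\<dots> = (12 * real k ^ 3 / real d) ^ g * ?w"
    by (simp add: power_divide)
  finally show "norm (real (card (weingarten_paths k m (pairing_norm k m + g))) * (- 1 / real d) ^ g)
      \<le> (12 * real k ^ 3 / real d) ^ g * ?w"
    by (simp add: abs_mult power_abs)
qed

lemma
  assumes m: "m \<in> pair_partitions k" and d: "12 * real k ^ 3 < real d"
  shows summable_paths: "summable (\<lambda>l. real (card (weingarten_paths k m l)) * (- 1 / real d) ^ l)"
    and path_series_excess: "path_series d k m = (- 1 / real d) ^ pairing_norm k m *
      (\<Sum>g. real (card (weingarten_paths k m (pairing_norm k m + g))) * (- 1 / real d) ^ g)"
proof -
  let ?z = "- 1 / real d" and ?N = "pairing_norm k m"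
  let ?f = "\<lambda>l. real (card (weingarten_paths k m l)) * ?z ^ l"
  have shift: "?f (g + ?N) = ?z ^ ?N * (real (card (weingarten_paths k m (?N + g))) * ?z ^ g)" for g
    by (simp add: power_add mult_ac add.commute)
  have "summable (\<lambda>g. ?f (g + ?N))"
    unfolding shift by (rule summable_mult[OF summable_excess[OF assms]])
  then show s: "summable ?f" using summable_iff_shift[of ?f ?N] by blast
  have "(\<Sum>l<?N. ?f l) = 0"
    using weingarten_paths_below_norm[OF m] by (intro sum.neutral) auto
  then have "suminf ?f = (\<Sum>g. ?f (g + ?N))"
    using suminf_split_initial_segment[OF s, of ?N] by simp
  also have "\<dots> = ?z ^ ?N * (\<Sum>g. real (card (weingarten_paths k m (?N + g))) * ?z ^ g)"
    unfolding shift by (rule suminf_mult[OF summable_excess[OF assms]])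
  finally show "path_series d k m = ?z ^ ?N * (\<Sum>g. real (card (weingarten_paths k m (?N + g))) * ?z ^ g)"
    by (simp add: path_series_def)
qed

lemma path_series_0: "path_series d 0 {} = 1"
proof -
  have "(\<lambda>l. real (card (weingarten_paths 0 {} l)) * (- 1 / real d) ^ l) = (\<lambda>l. if l = 0 then 1 else 0)"
    by (auto simp: weingarten_paths_0)
  then show ?thesis unfolding path_series_def using suminf_finite[of "{0}" "\<lambda>l. if l = (0::nat) then 1 else (0::real)"] by simp
qed

text \<open>Each solid arrow contributes a factor \<open>- 1 / d\<close>, so multiplying by
  \<open>d\<close> brings the sum over arrows to the left with a plus sign. The \<open>d\<close> on
  the right matches the normalisation by \<open>d^k\<close>, whose exponent differs by one between
  the two levels.\<close>

lemma path_series_recursion: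
  assumes m: "m \<in> pair_partitions (Suc n)" and d: "12 * real (Suc n) ^ 3 < real d"
  shows "real d * path_series d (Suc n) m
      + (\<Sum>t\<in>{1..2*n}. path_series d (Suc n) (perm_act (Transposition.transpose t (2*n+1)) m))
    = (if {2*n+1, 2*n+2} \<in> m then real d * path_series d n (m - {{2*n+1, 2*n+2}}) else 0)"
proof -
  let ?z = "- 1 / real d"
  let ?step = "\<lambda>i. perm_act (Transposition.transpose i (2*n+1)) m" and ?down = "m - {{2*n+1, 2*n+2}}"
  let ?F = "\<lambda>k m l. real (card (weingarten_paths k m l)) * ?z ^ l"
  let ?D = "\<lambda>l. if {2*n+1, 2*n+2} \<in> m then ?F n ?down l else 0"
  have "real n ^ 3 \<le> real (Suc n) ^ 3" by (intro power_mono) auto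
  then have d': "12 * real n ^ 3 < real d" using d by linarith
  have "0 \<le> real (Suc n) ^ 3" by simp
  then have d0: "0 < real d" using d by linarith
  have sD: "summable ?D"
  proof (cases "{2*n+1, 2*n+2} \<in> m")
    case True
    with summable_paths[OF pair_partitions_remove[OF m True] d'] show ?thesis by (simp only: if_True)
  qed simp
  have sS: "summable (?F (Suc n) (?step i))" if "i \<in> {1..2*n}" for i
    by (rule summable_paths[OF pair_partitions_step[OF m that] d])
  have F: "?F (Suc n) m (Suc l) = ?z * (\<Sum>i\<in>{1..2*n}. ?F (Suc n) (?step i) l) + ?D (Suc l)" for l
    unfolding card_weingarten_paths_Suc[OF m] by (simp add: sum_distrib_left sum_distrib_right algebra_simps)
  \<comment> \<open>The term \<open>l = 0\<close> stands apart, since it admits only the dashed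
    arrow.\<close>
  have F0: "?F (Suc n) m 0 = ?D 0" unfolding card_weingarten_paths_Suc_0[OF m] by simp
  have "path_series d (Suc n) m = (\<Sum>l. ?F (Suc n) m (Suc l)) + ?F (Suc n) m 0"
    unfolding path_series_def using suminf_split_head[OF summable_paths[OF m d]] by linarith
  also have "(\<Sum>l. ?F (Suc n) m (Suc l)) =
      (\<Sum>l. ?z * (\<Sum>i\<in>{1..2*n}. ?F (Suc n) (?step i) l)) + (\<Sum>l. ?D (Suc l))"
    unfolding F using sS summable_Suc_iff[of ?D] sD
    by (intro suminf_add[symmetric] summable_mult summable_sum) blast+
  also have "(\<Sum>l. ?z * (\<Sum>i\<in>{1..2*n}. ?F (Suc n) (?step i) l)) =
      ?z * (\<Sum>l. \<Sum>i\<in>{1..2*n}. ?F (Suc n) (?step i) l)"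
    using sS by (intro suminf_mult summable_sum)
  also have "(\<Sum>l. \<Sum>i\<in>{1..2*n}. ?F (Suc n) (?step i) l) = (\<Sum>i\<in>{1..2*n}. path_series d (Suc n) (?step i))"
    unfolding path_series_def using sS by (intro suminf_sum)
  also have "(\<Sum>l. ?D (Suc l)) = suminf ?D - ?D 0" by (rule suminf_split_head[OF sD])
  also have "suminf ?D = (if {2*n+1, 2*n+2} \<in> m then path_series d n ?down else 0)"
    by (simp add: path_series_def)
  finally have "path_series d (Suc n) m = ?z * (\<Sum>i\<in>{1..2*n}. path_series d (Suc n) (?step i)) +
      (if {2*n+1, 2*n+2} \<in> m then path_series d n ?down else 0)"
    unfolding F0 by simp
  then have "real d * path_series d (Suc n) m = real d * ?z * (\<Sum>i\<in>{1..2*n}. path_series d (Suc n) (?step i)) +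
      real d * (if {2*n+1, 2*n+2} \<in> m then path_series d n ?down else 0)"
    by (simp only: distrib_left mult.assoc)
  then show ?thesis using d0 by simp
qed

section \<open>The Weingarten functions as path series\<close>

lemma index_pattern_transpose:
  assumes "index_pattern (Suc n) j m" "t \<in> {1..2*n}"
  shows "index_pattern (Suc n) (j \<circ> Transposition.transpose t (2*n+1))
    (perm_act (Transposition.transpose t (2*n+1)) m)"
  unfolding index_pattern_def
proof (intro ballI impI)
  let ?\<tau> = "Transposition.transpose t (2*n+1)"
  fix r s assume rs: "r \<in> {1..2*Suc n}" "s \<in> {1..2*Suc n}" "r \<noteq> s"
  have "?\<tau> r \<in> {1..2*Suc n}" "?\<tau> s \<in> {1..2*Suc n}"
    using rs assms(2) by (auto simp: Transposition.transpose_def)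
  moreover have "?\<tau> r \<noteq> ?\<tau> s" using rs(3) by (metis transpose_involutory)
  ultimately show "((j \<circ> ?\<tau>) r = (j \<circ> ?\<tau>) s) = ({r, s} \<in> perm_act ?\<tau> m)"
    using assms(1) unfolding index_pattern_def mem_perm_act_transpose comp_apply by blast
qed

lemma index_pattern_remove:
  assumes "index_pattern (Suc n) j m"
  shows "index_pattern n j (m - {{2*n+1, 2*n+2}})"
  unfolding index_pattern_def
proof (intro ballI impI)
  fix r s assume rs: "r \<in> {1..2*n}" "s \<in> {1..2*n}" "r \<noteq> s"
  then have "{r, s} \<noteq> {2*n+1, 2*n+2}" by (auto simp: doubleton_eq_iff)
  moreover have "(j r = j s) = ({r, s} \<in> m)" using assms rs unfolding index_pattern_def by auto
  ultimately show "(j r = j s) = ({r, s} \<in> m - {{2*n+1, 2*n+2}})" by simp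
qed

lemma index_pattern_trivial_remove:
  assumes "index_pattern (Suc n) i (trivial_pairing (Suc n))"
  shows "index_pattern n i (trivial_pairing n)"
proof -
  have "trivial_pairing n = trivial_pairing (Suc n) - {{2*n+1, 2*n+2}}"
    using pairing_on_subset[OF pairing_on_trivial_pairing, of "{2*n+1, 2*n+2}" n]
    by (auto simp: trivial_pairing_Suc)
  then show ?thesis using index_pattern_remove[OF assms] by simp
qed

lemma finite_pair_partitions: "finite (pair_partitions k)"
  by (rule finite_subset[of _ "Pow (Pow {1..2*k})"]) (auto simp: pair_partitions_def partition_on_def)

context orthogonal_haar
begin

text \<open>The Weingarten functions and the path series satisfy the same linear recursion, whose solution
  is unique: the difference of two bounded solutions contracts by the factor \<open>2n / d < 1\<close>.\<close>

lemma Wg_O_eq_path_series: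
  assumes d: "d = CARD('n)" "12 * real k ^ 3 < real d"
    and i: "index_pattern k i (trivial_pairing k)"
    and "m \<in> pair_partitions k" "index_pattern k j m"
  shows "real d ^ k * Wg_O M k i j = path_series d k m"
  using assms(2-)
proof (induction k arbitrary: m j)
  case 0
  then show ?case by (simp add: pair_partitions_0 path_series_0)
next
  case (Suc n)
  let ?step = "\<lambda>t m. perm_act (Transposition.transpose t (2*n+1)) m"
  have n: "real n ^ 3 \<le> real (Suc n) ^ 3" "real (Suc n) \<le> real (Suc n) ^ 3"
    by (intro power_mono; simp) (rule self_le_power; simp)
  then have d': "12 * real n ^ 3 < real d" and dn: "2 * real n < real d" and d0: "0 < real d"
    using Suc.prems(1) by linarith+
  define \<Delta> where "\<Delta> j m = real d ^ Suc n * Wg_O M (Suc n) i j - path_series d (Suc n) m" for j m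
  have rec: "real d * \<Delta> j m = - (\<Sum>t\<in>{1..2*n}. \<Delta> (j \<circ> Transposition.transpose t (2*n+1)) (?step t m))"
    if m: "m \<in> pair_partitions (Suc n)" and j: "index_pattern (Suc n) j m" for j m
  proof -
    have "(j (2*n+1) = j (2*n+2)) = ({2*n+1, 2*n+2} \<in> m)"
      using j unfolding index_pattern_def by simp
    moreover have "real d ^ n * Wg_O M n i j = path_series d n (m - {{2*n+1, 2*n+2}})"
      if "{2*n+1, 2*n+2} \<in> m"
      by (rule Suc.IH[OF d' index_pattern_trivial_remove[OF Suc.prems(2)]
            pair_partitions_remove[OF m that] index_pattern_remove[OF j]])
    ultimately have "real d ^ Suc n * (if j (2*n+1) = j (2*n+2) then Wg_O M n i j else 0) =
        (if {2*n+1, 2*n+2} \<in> m then real d * path_series d n (m - {{2*n+1, 2*n+2}}) else 0)"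
      by (simp add: mult.assoc)
    with Wg_O_recursion[OF Suc.prems(2), of j, folded d(1)]
    have "real d ^ Suc n * (real d * Wg_O M (Suc n) i j +
        (\<Sum>t\<in>{1..2*n}. Wg_O M (Suc n) i (j \<circ> Transposition.transpose t (2*n+1)))) =
      real d * path_series d (Suc n) m + (\<Sum>t\<in>{1..2*n}. path_series d (Suc n) (?step t m))"
      using path_series_recursion[OF m Suc.prems(1)] by simp
    then show ?thesis
      by (simp add: \<Delta>_def sum_subtractf sum_distrib_left algebra_simps)
  qed
  \<comment> \<open>The bound must be uniform in \<open>j\<close> and \<open>m\<close>, since the
    recursion changes both: there are finitely many \<open>m\<close>, and the integrals are at most
    1 in absolute value for every \<open>j\<close>.\<close>
  define B where "B = real d ^ Suc n + (\<Sum>m\<in>pair_partitions (Suc n). \<bar>path_series d (Suc n) m\<bar>)"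
  have bound: "\<bar>\<Delta> j m\<bar> \<le> (2 * real n / real d) ^ r * B"
    if "m \<in> pair_partitions (Suc n)" "index_pattern (Suc n) j m" for j m r
    using that
  proof (induction r arbitrary: j m)
    case 0
    have "\<bar>\<Delta> j m\<bar> \<le> \<bar>real d ^ Suc n * Wg_O M (Suc n) i j\<bar> + \<bar>path_series d (Suc n) m\<bar>"
      unfolding \<Delta>_def by (rule abs_triangle_ineq4)
    also have "\<bar>real d ^ Suc n * Wg_O M (Suc n) i j\<bar> \<le> real d ^ Suc n * 1"
      unfolding abs_mult using abs_Wg_O_le_1 by (intro mult_mono) auto
    also have "\<bar>path_series d (Suc n) m\<bar> \<le> (\<Sum>m\<in>pair_partitions (Suc n). \<bar>path_series d (Suc n) m\<bar>)"
      using 0 finite_pair_partitions by (intro member_le_sum) auto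
    finally show ?case by (simp add: B_def)
  next
    case (Suc r)
    let ?b = "(2 * real n / real d) ^ r * B"
    have "real d * \<bar>\<Delta> j m\<bar> = \<bar>real d * \<Delta> j m\<bar>" by (simp add: abs_mult)
    also have "\<dots> = \<bar>\<Sum>t\<in>{1..2*n}. \<Delta> (j \<circ> Transposition.transpose t (2*n+1)) (?step t m)\<bar>"
      by (simp only: rec[OF Suc.prems] abs_minus)
    also have "\<dots> \<le> (\<Sum>t\<in>{1..2*n}. \<bar>\<Delta> (j \<circ> Transposition.transpose t (2*n+1)) (?step t m)\<bar>)"
      by (rule sum_abs)
    also have "\<dots> \<le> (\<Sum>t\<in>{1..2*n}. ?b)"
      by (intro sum_mono Suc.IH pair_partitions_step[OF Suc.prems(1)] index_pattern_transpose[OF Suc.prems(2)])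
    also have "\<dots> = 2 * real n * ?b" by simp
    finally show ?case using d0 by (simp add: field_simps)
  qed
  have "(\<lambda>r. (2 * real n / real d) ^ r * B) \<longlonglongrightarrow> 0 * B"
    using dn d0 by (intro tendsto_mult_right LIMSEQ_power_zero) simp
  then have "\<bar>\<Delta> j m\<bar> \<le> 0 * B"
    using bound[OF Suc.prems(3,4)] by (intro LIMSEQ_le_const) auto
  then show ?case by (simp add: \<Delta>_def)
qed

end

text \<open>For the upper bound the odd terms are dropped and the even ones replaced by
  \<open>a 0 * x^g\<close>; for the lower bound the roles are exchanged, with the term at 0 kept.
  The combinations \<open>(x^g + (- x)^g) / 2\<close> and \<open>(x^g - (- x)^g) / 2\<close> pick
  out the parities, so two geometric series give both sums.\<close>

lemma alternating_series_bounds: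
  fixes a :: "nat \<Rightarrow> real"
  assumes a: "\<And>g. 0 \<le> a g" "\<And>g. a g \<le> a 0 * x ^ g" and x: "0 \<le> x" "x < 1"
    and s: "summable (\<lambda>g. a g * (- 1) ^ g)"
  shows "(\<Sum>g. a g * (- 1) ^ g) \<le> a 0 / (1 - x\<^sup>2)"
    and "a 0 * ((1 - 2 * x) / (1 - x\<^sup>2)) \<le> (\<Sum>g. a g * (- 1) ^ g)"
proof -
  have x2: "0 < 1 - x\<^sup>2" using x by (simp add: power_less_one_iff abs_square_less_1)
  have p: "(\<lambda>g. x ^ g) sums (1 / (1 - x))" and n: "(\<lambda>g. (- x) ^ g) sums (1 / (1 + x))"
    using geometric_sums[of x] geometric_sums[of "- x"] x by auto
  have "(\<lambda>g. a 0 / 2 * (x ^ g + (- x) ^ g)) sums (a 0 / 2 * (1 / (1 - x) + 1 / (1 + x)))"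
    by (intro sums_mult sums_add p n)
  also have "a 0 / 2 * (1 / (1 - x) + 1 / (1 + x)) = a 0 / (1 - x\<^sup>2)"
    using x x2 by (simp add: field_simps power2_eq_square)
  finally have even: "(\<lambda>g. a 0 / 2 * (x ^ g + (- x) ^ g)) sums (a 0 / (1 - x\<^sup>2))" .
  have "(\<Sum>g. a g * (- 1) ^ g) \<le> (\<Sum>g. a 0 / 2 * (x ^ g + (- x) ^ g))"
  proof (rule suminf_le[OF _ s sums_summable[OF even]])
    fix g show "a g * (- 1) ^ g \<le> a 0 / 2 * (x ^ g + (- x) ^ g)"
      using a[of g] by (cases "even g") simp_all
  qed
  then show "(\<Sum>g. a g * (- 1) ^ g) \<le> a 0 / (1 - x\<^sup>2)" using sums_unique[OF even] by simp
  have "(\<lambda>g. (if g = 0 then a 0 else 0) - a 0 / 2 * (x ^ g - (- x) ^ g)) sums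
      (a 0 - a 0 / 2 * (1 / (1 - x) - 1 / (1 + x)))"
    using sums_If_finite_set[of "{0::nat}" "\<lambda>_. a 0"]
    by (intro sums_diff sums_mult p n) simp
  also have "a 0 - a 0 / 2 * (1 / (1 - x) - 1 / (1 + x)) = a 0 * ((1 - x - x\<^sup>2) / (1 - x\<^sup>2))"
    using x x2 by (simp add: field_simps power2_eq_square)
  finally have odd: "(\<lambda>g. (if g = 0 then a 0 else 0) - a 0 / 2 * (x ^ g - (- x) ^ g)) sums
      (a 0 * ((1 - x - x\<^sup>2) / (1 - x\<^sup>2)))" .
  have "(\<Sum>g. (if g = 0 then a 0 else 0) - a 0 / 2 * (x ^ g - (- x) ^ g)) \<le> (\<Sum>g. a g * (- 1) ^ g)"
  proof (rule suminf_le[OF _ sums_summable[OF odd] s])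
    fix g show "(if g = 0 then a 0 else 0) - a 0 / 2 * (x ^ g - (- x) ^ g) \<le> a g * (- 1) ^ g"
      using a[of g] by (cases "even g"; cases "g = 0") simp_all
  qed
  \<comment> \<open>The lower sum has numerator \<open>1 - x - x^2\<close>;
    \<open>x^2 \<le> x\<close> weakens it to \<open>1 - 2 x\<close>.\<close>
  moreover have "a 0 * ((1 - 2 * x) / (1 - x\<^sup>2)) \<le> a 0 * ((1 - x - x\<^sup>2) / (1 - x\<^sup>2))"
  proof -
    have "x\<^sup>2 \<le> x" using x by (simp add: power2_eq_square mult_left_le)
    then show ?thesis using a(1)[of 0] x2 by (intro mult_left_mono divide_right_mono) auto
  qed
  ultimately show "a 0 * ((1 - 2 * x) / (1 - x\<^sup>2)) \<le> (\<Sum>g. a g * (- 1) ^ g)"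
    using sums_unique[OF odd] by simp
qed

theorem theorem4p11:
  fixes M :: "(real ^ 'n ^ 'n) measure"
    and k d :: nat
    and m :: "nat set set"
    and i j :: "nat \<Rightarrow> 'n"
  assumes "m \<in> pair_partitions k"
    and "d = CARD('n)"
    and "2 * k \<le> d"
    and "12 * real k powr (7/2) < real d"
    and "haar_orthogonal M"
    and "index_pattern k i (trivial_pairing k)"
    and "index_pattern k j m"
  shows "real (card (weingarten_paths k m (pairing_norm k m))) *
           ((1 - 24 * real k powr (7/2) / real d) / (1 - 144 * real k ^ 7 / real d ^ 2))
         \<le> (- 1) ^ pairing_norm k m * real d ^ (pairing_norm k m + k) * Wg_O M k i j \<and>
         (- 1) ^ pairing_norm k m * real d ^ (pairing_norm k m + k) * Wg_O M k i j
         \<le> real (card (weingarten_paths k m (pairing_norm k m))) /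
             (1 - 144 * real k ^ 7 / real d ^ 2)"
proof -
  interpret orthogonal_haar M by unfold_locales (rule assms(5))
  define N where "N = pairing_norm k m"
  define c where "c = real k powr (7/2)"
  define x where "x = 12 * c / real d"
  define a where "a g = real (card (weingarten_paths k m (N + g))) / real d ^ g" for g
  have d0: "0 < real d" by (simp add: assms(2))
  have c2: "c\<^sup>2 = real k ^ 7"
  proof (cases "k = 0")
    case False
    then have "c\<^sup>2 = real k powr 7" by (simp add: c_def power2_eq_square flip: powr_add)
    then show ?thesis using False by (simp add: powr_numeral)
  qed (simp add: c_def)
  \<comment> \<open>The excess bound has ratio \<open>12 k^3 / d\<close>; passing to
    \<open>c\<close> gives the ratio \<open>x\<close> of the statement. At \<open>k = 0\<close> both
    sides are 0, as \<open>0 powr (7/2) = 0\<close>.\<close>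
  have k3: "real k ^ 3 \<le> c"
  proof (cases "k = 0")
    case False
    then have "real k powr 3 \<le> c" unfolding c_def by (intro powr_mono) auto
    then show ?thesis using False by (simp add: powr_numeral)
  qed (simp add: c_def)
  have small: "12 * real k ^ 3 < real d" using assms(4) k3 by (simp add: c_def)
  have x: "0 \<le> x" "x < 1" using d0 assms(4) by (simp_all add: x_def c_def)
  have x2: "x\<^sup>2 = 144 * real k ^ 7 / real d ^ 2"
    by (simp add: x_def power_divide power_mult_distrib c2)
  have a0: "a 0 = real (card (weingarten_paths k m N))" by (simp add: a_def)
  have az: "a g * (- 1) ^ g = real (card (weingarten_paths k m (N + g))) * (- 1 / real d) ^ g" for g
    unfolding a_def power_divide by simp
  have s: "summable (\<lambda>g. a g * (- 1) ^ g)"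
    unfolding az N_def by (rule summable_excess[OF assms(1) small])
  have "a g \<le> a 0 * x ^ g" for g
  proof -
    have "a g \<le> (12 * real k ^ 3) ^ g * a 0 / real d ^ g"
      unfolding a0 unfolding a_def N_def using excess_le[OF assms(1)] by (intro divide_right_mono) auto
    also have "\<dots> \<le> (12 * c) ^ g * a 0 / real d ^ g"
      using k3 a0 by (intro divide_right_mono mult_right_mono power_mono) auto
    also have "\<dots> = a 0 * x ^ g" by (simp add: x_def power_divide)
    finally show ?thesis .
  qed
  note bounds = alternating_series_bounds[of a x, OF _ this x s]
  have "(- 1) ^ N * real d ^ (N + k) * Wg_O M k i j = (- real d) ^ N * path_series d k m"
    using Wg_O_eq_path_series[OF assms(2) small assms(6,1,7)]
    by (simp add: power_add mult.assoc power_minus[of "real d"])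
  \<comment> \<open>The sign and \<open>d^N\<close> cancel the leading factor
    \<open>(- 1 / d)^N\<close> of the series; \<open>d^k\<close> was used up in passing from the
    integral to the series.\<close>
  also have "\<dots> = ((- real d) * (- 1 / real d)) ^ N * (\<Sum>g. a g * (- 1) ^ g)"
    unfolding path_series_excess[OF assms(1) small] az N_def by (simp only: power_mult_distrib mult.assoc)
  also have "(- real d) * (- 1 / real d) = 1" using d0 by simp
  finally have W: "(- 1) ^ N * real d ^ (N + k) * Wg_O M k i j = (\<Sum>g. a g * (- 1) ^ g)" by simp
  have "24 * c / real d = 2 * x" by (simp add: x_def)
  with bounds show ?thesis
    unfolding N_def[symmetric] c_def[symmetric] W x2[symmetric] a0[symmetric] by (simp add: a_def)
qed

end
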